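(* Let $w\in A_2(\mathbb R^n)$ with $[w]_{A_2}\le M$. Let $\mathcal Q_{\rm ref}=Q_R(P_0)$ be a fixed reference intrinsic cylinder, and let $E\subset F$ be measurable sets. Suppose that there exist an integer $L\ge1$ and a number $r_0\in(0,1)$ satisfying $Lr_0^2\le1$ such that the following implication holds: whenever $Q_r(P)\subset\mathcal Q_{\rm ref}$ and $$\mu_w(E\cap Q_r(P))>\tfrac12\mu_w(Q_r(P)),$$ then $$r<r_0R,\qquad\mu_w\bigl(\overline Q_r^{\,L}(P)\setminus F\bigr)=0.$$ Under these assumptions there exist $c\in(0,1)$, $C<\infty$, and $\sigma_0\in(0,2]$, depending only on $m,k,M$ and the fixed reference geometry, such that $$\mu_w(E\cap\mathcal Q_{\rm ref})\le\frac{L+1}{L}(1-c)\,\mu_w(F\cap\mathcal Q_{\rm ref})+CLr_0^{\sigma_0}\,\mu_w(\mathcal Q_{\rm ref}).$$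
   Context: Let $m\ge1$, $k\ge0$, $n=m+k$, $x=(v,z)\in\mathbb R^m\times\mathbb R^k$ ($z$ omitted when $k=0$), $y\in\mathbb R^m$, $t\in\mathbb R$. $w=w(x)$ is positive a.e., $w,w^{-1}\in L^1_{\rm loc}(\mathbb R^n)$, $[w]_{A_2}:=\sup_{\mathcal B}\bigl(\frac1{|\mathcal B|}\int_{\mathcal B}w\,dx\bigr)\bigl(\frac1{|\mathcal B|}\int_{\mathcal B}w^{-1}dx\bigr)\le M$ over Euclidean balls in $\mathbb R^n$; $d\mu_w=w(x)\,dx\,dy\,dt$. For $P=(v_P,z_P,y_P,t_P)$ and $r>0$, the intrinsic cylinder is $Q_r(P)=\{(v,z,y,t):|(v,z)-(v_P,z_P)|<r,\ |y-y_P-(t-t_P)v_P|<r^3,\ t_P-r^2<t<t_P\}$, and for an integer $L\ge1$ its forward stack is $$\overline Q_r^{\,L}(P)=\{(v,z,y,t):|(v,z)-(v_P,z_P)|<r,\ |y-y_P-(t-t_P)v_P|<(L+2)r^3,\ t_P<t<t_P+Lr^2\}.$$ *)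

theory Defs
  imports "HOL-Analysis.Analysis"
begin

text \<open>
  The splitting \<open>x = (v, z)\<close> of \<open>\<real>\<^sup>n = \<real>\<^sup>m \<times> \<real>\<^sup>k\<close> is given by an injection \<open>\<iota>\<close> of the
  index type \<open>'m\<close> of \<open>v\<close> into the index type \<open>'n\<close> of \<open>x\<close>: the coordinates in the range of
  \<open>\<iota>\<close> form \<open>v\<close>, the remaining \<open>k = CARD('n) - CARD('m)\<close> ones form \<open>z\<close>. This allows
  \<open>k = 0\<close>, which a separate (necessarily nonempty) index type for \<open>z\<close> would not. The
  instances \<open>'n = 'm + 'k\<close>, \<open>\<iota> = Inl\<close> and \<open>'n = 'm\<close>, \<open>\<iota> = id\<close> are the literal splittings
  for \<open>k \<ge> 1\<close> and \<open>k = 0\<close>.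
\<close>

type_synonym ('n, 'm) point = "(real ^ 'n) \<times> (real ^ 'm) \<times> real"

definition velocity :: "('m \<Rightarrow> 'n) \<Rightarrow> real ^ 'n \<Rightarrow> real ^ 'm" where
  "velocity \<iota> x = (\<chi> i. x $ \<iota> i)"

fun cylinder ::
  "('m::finite \<Rightarrow> 'n::finite) \<Rightarrow> real \<Rightarrow> ('n, 'm) point \<Rightarrow> ('n, 'm) point set" where
  "cylinder \<iota> r (xP, yP, tP) =
     {(x, y, t). norm (x - xP) < r
        \<and> norm (y - yP - (t - tP) *\<^sub>R velocity \<iota> xP) < r ^ 3
        \<and> tP - r\<^sup>2 < t \<and> t < tP}"

fun forward_stack ::
  "('m::finite \<Rightarrow> 'n::finite) \<Rightarrow> nat \<Rightarrow> real \<Rightarrow> ('n, 'm) point \<Rightarrow> ('n, 'm) point set" where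
  "forward_stack \<iota> L r (xP, yP, tP) =
     {(x, y, t). norm (x - xP) < r
        \<and> norm (y - yP - (t - tP) *\<^sub>R velocity \<iota> xP) < (real L + 2) * r ^ 3
        \<and> tP < t \<and> t < tP + real L * r\<^sup>2}"

definition locally_integrable :: "('a::euclidean_space \<Rightarrow> real) \<Rightarrow> bool" where
  "locally_integrable f \<longleftrightarrow> (\<forall>K. compact K \<longrightarrow> f absolutely_integrable_on K)"

text \<open>The value \<open>\<infinity>\<close> is allowed; \<open>w\<close> is an \<open>A\<^sub>2\<close> weight iff \<open>A2_const w\<close> is finite.\<close>

definition A2_const :: "('a::euclidean_space \<Rightarrow> real) \<Rightarrow> ennreal" where
  "A2_const w = (SUP (a, r) \<in> UNIV \<times> {0<..}.
     ((\<integral>\<^sup>+x\<in>ball a r. ennreal (w x) \<partial>lebesgue) / emeasure lebesgue (ball a r)) *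
     ((\<integral>\<^sup>+x\<in>ball a r. ennreal (inverse (w x)) \<partial>lebesgue) / emeasure lebesgue (ball a r)))"

definition A2_weight_le :: "real \<Rightarrow> ('a::euclidean_space \<Rightarrow> real) \<Rightarrow> bool" where
  "A2_weight_le M w \<longleftrightarrow>
     (AE x in lebesgue. 0 < w x) \<and> locally_integrable w \<and>
     locally_integrable (\<lambda>x. inverse (w x)) \<and> A2_const w \<le> ennreal M"

definition weighted_measure ::
  "(real ^ 'n \<Rightarrow> real) \<Rightarrow> ('n::finite, 'm::finite) point measure" where
  "weighted_measure w = density lebesgue (\<lambda>(x, y, t). ennreal (w x))"

end

theory Submission
  imports Defs
begin

text \<open>
  The argument is the ink-spots covering argument of Krylov and Safonov in the kinetic geometry,
  with Lebesgue measure replaced by a measure \<open>\<mu>\<close> whose density \<open>w\<close> depends on \<open>x\<close> only.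

  Write \<open>Q\<close> for the reference cylinder and \<open>P\<^sub>0 = (x\<^sub>0, y\<^sub>0, t\<^sub>0)\<close> for its top centre. Every point \<open>X\<close> of
  \<open>Q\<close> that lies deeper than \<open>2 r\<^sub>0\<^sup>2 R\<^sup>3\<close> in the \<open>y\<close>-direction carries a one-parameter family of
  cylinders of radius \<open>s R\<close>, \<open>0 < s \<le> r\<^sub>0\<close>, which contain \<open>X\<close> and stay in \<open>Q\<close>; in \<open>x\<close> and \<open>t\<close> they are images
  of \<open>Q\<close> under contractions towards \<open>X\<close>. At \<open>s = r\<^sub>0\<close> the set \<open>E\<close> cannot fill more than half of the
  cylinder, since that would force \<open>s R < r\<^sub>0 R\<close>. As the filled fraction is continuous in \<open>s\<close>,
  either it never exceeds one half, or some cylinder of the family is filled by a fraction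
  in \<open>(1/2, 3/4]\<close>; this dichotomy is \<open>stopping\<close>. Points of \<open>E\<close> of the first kind form a null set, by the
  density argument of \<open>deep_outside_spots_null\<close>. Hence \<open>E\<close>, up to its shallow part, lies almost
  everywhere in the union \<open>G\<close> of the cylinders that are filled by a fraction in \<open>(1/2, 3/4]\<close>.

  Two facts about \<open>G\<close> remain. First, a definite part of \<open>G\<close> is free of \<open>E\<close>: a Vitali selection,
  together with the doubling property that \<open>A\<^sub>2\<close> gives to \<open>w\<close>, bounds \<open>\<mu>(G)\<close> by a
  multiple of \<open>\<mu>(G - E)\<close> (\<open>covering_lemma\<close>), and so \<open>\<mu>(E \<inter> G) \<le> (1 - c) \<mu>(G)\<close>. Second, \<open>\<mu>(G)\<close> is
  at most \<open>(L + 1)/L\<close> times the measure of the union of the forward stacks (\<open>stacking_lemma\<close>):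
  along a free trajectory \<open>(x, y + s v, t + s)\<close> a cylinder occupies at most the time
  interval \<open>(t\<^sub>P - r\<^sup>2, t\<^sub>P)\<close>, and if it is met at all, its stack occupies all of
  \<open>(t\<^sub>P, t\<^sub>P + L r\<^sup>2)\<close>, so that the claim becomes one about intervals.

  The stacks lie in \<open>F\<close> up to null sets, but may leave \<open>Q\<close>. They do so only in \<open>y\<close> and \<open>t\<close>, by
  amounts of relative order \<open>L r\<^sub>0\<^sup>2\<close>, because \<open>|x - x\<^sub>0| < R\<close> persists on a stack. The weight is
  constant in these variables, so the leak has measure of order \<open>L r\<^sub>0\<^sup>2 \<mu>(Q)\<close>; the shallow part of \<open>E\<close> has measure of order
  \<open>r\<^sub>0\<^sup>2 \<mu>(Q)\<close> for the same reason. This gives the theorem with exponent \<open>\<sigma>\<^sub>0 = 2\<close>.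
\<close>

section \<open>Selection of disjoint sets and stacking of intervals\<close>

text \<open>
  The greedy choice: take a set \<open>B i\<close> of largest radius, discard the sets that meet it, and repeat.
  The geometry enters through \<open>D i\<close>, which is required to swallow every set that \<open>B i\<close> discards.
\<close>

lemma finite_vitali_selection:
  fixes rad :: "'i \<Rightarrow> real" and B :: "'i \<Rightarrow> 'a set"
  assumes "finite I"
    and absorb: "\<And>i j. i \<in> I \<Longrightarrow> j \<in> I \<Longrightarrow> rad j \<le> rad i \<Longrightarrow> B i \<inter> B j \<noteq> {} \<Longrightarrow> B j \<subseteq> D i"
    and self: "\<And>i. i \<in> I \<Longrightarrow> B i \<subseteq> D i"
  shows "\<exists>J\<subseteq>I. disjoint_family_on B J \<and> (\<Union>i\<in>I. B i) \<subseteq> (\<Union>j\<in>J. D j)"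
  using assms
proof (induction "card I" arbitrary: I rule: less_induct)
  case less
  show ?case
  proof (cases "I = {}")
    case True
    then show ?thesis by (auto simp: disjoint_family_on_def)
  next
    case False
    obtain i where i: "i \<in> I" and mx: "\<And>j. j \<in> I \<Longrightarrow> rad j \<le> rad i"
    proof -
      have "Max (rad ` I) \<in> rad ` I" using less.prems(1) False by (intro Max_in) auto
      then obtain i where "i \<in> I" "rad i = Max (rad ` I)" by auto
      then show ?thesis using that[of i] less.prems(1) by simp
    qed
    define I' where "I' = {j \<in> I. B i \<inter> B j = {} \<and> j \<noteq> i}"
    have sub: "I' \<subseteq> I" and "i \<notin> I'" by (auto simp: I'_def)
    then have "card I' < card I"
      using i less.prems(1) by (intro psubset_card_mono) auto
    moreover have "finite I'" using sub less.prems(1) finite_subset by blast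
    ultimately obtain J where J: "J \<subseteq> I'" "disjoint_family_on B J"
      "(\<Union>i\<in>I'. B i) \<subseteq> (\<Union>j\<in>J. D j)"
      using less.hyps[of I'] less.prems sub by (meson subsetD)
    have "disjoint_family_on B (insert i J)"
      using J(1,2) by (fastforce simp: disjoint_family_on_def I'_def)
    moreover have "(\<Union>j\<in>I. B j) \<subseteq> (\<Union>j\<in>insert i J. D j)"
    proof
      fix x assume "x \<in> (\<Union>j\<in>I. B j)"
      then obtain j where j: "j \<in> I" "x \<in> B j" by auto
      show "x \<in> (\<Union>j\<in>insert i J. D j)"
      proof (cases "j \<in> I'")
        case True
        then show ?thesis using J(3) j by auto
      next
        case False
        then have "B i \<inter> B j \<noteq> {} \<or> j = i" using j by (auto simp: I'_def)
        then have "B j \<subseteq> D i" using less.prems(2)[OF i j(1) mx[OF j(1)]] less.prems(3)[OF i] by auto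
        then show ?thesis using j by auto
      qed
    qed
    moreover have "insert i J \<subseteq> I" using i J(1) sub by auto
    ultimately show ?thesis by blast
  qed
qed

text \<open>
  For pairwise disjoint stacks \<open>(a, a + L h)\<close> the ratio of lengths is exactly \<open>(L + 1)/L\<close>, interval by
  interval. The induction on the number of stacks merges two that overlap, which reduces to this case.
\<close>

lemma interval_stacking_finite:
  fixes S :: "(real \<times> real) set" and L :: real
  assumes "finite S" and "\<And>a h. (a, h) \<in> S \<Longrightarrow> 0 < h" and L: "0 < L"
  shows "emeasure lborel (\<Union>(a, h)\<in>S. {a - h<..<a + L * h})
    \<le> ennreal ((L + 1) / L) * emeasure lborel (\<Union>(a, h)\<in>S. {a<..<a + L * h})"
  using assms(1,2)
proof (induction "card S" arbitrary: S rule: less_induct)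
  case less
  let ?U = "\<lambda>(a, h). {a<..<a + L * h}" and ?V = "\<lambda>(a, h). {a - h<..<a + L * h}"
  show ?case
  proof (cases "disjoint_family_on ?U S")
    case True
    have "emeasure lborel (\<Union>p\<in>S. ?V p) \<le> (\<Sum>p\<in>S. emeasure lborel (?V p))"
      using less.prems(1) by (intro emeasure_subadditive_finite) auto
    also have "\<dots> = (\<Sum>p\<in>S. ennreal ((L + 1) / L) * emeasure lborel (?U p))"
    proof (rule sum.cong[OF refl], clarify)
      fix a h assume "(a, h) \<in> S"
      then have "0 < h" using less.prems(2) by auto
      have len: "a + L * h - (a - h) = (L + 1) / L * (L * h)" using L by (simp add: field_simps)
      have "0 < L * h" using L \<open>0 < h\<close> by simp
      then have "emeasure lborel {a - h<..<a + L * h} = ennreal (a + L * h - (a - h))"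
        using \<open>0 < h\<close> by (intro emeasure_lborel_Ioo) linarith
      also have "\<dots> = ennreal ((L + 1) / L * (L * h))" unfolding len ..
      also have "\<dots> = ennreal ((L + 1) / L) * emeasure lborel {a<..<a + L * h}"
        using L \<open>0 < h\<close> by (subst ennreal_mult) auto
      finally show "emeasure lborel {a - h<..<a + L * h}
          = ennreal ((L + 1) / L) * emeasure lborel {a<..<a + L * h}" .
    qed
    also have "\<dots> = ennreal ((L + 1) / L) * emeasure lborel (\<Union>p\<in>S. ?U p)"
      using True less.prems(1)
      by (subst sum_emeasure[symmetric]) (auto simp: sum_distrib_left)
    finally show ?thesis .
  next
    case False
    then obtain p q where pq: "p \<in> S" "q \<in> S" "p \<noteq> q" "?U p \<inter> ?U q \<noteq> {}"
      unfolding disjoint_family_on_def by blast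
    obtain a h b k where "p = (a, h)" "q = (b, k)" by (meson surj_pair)
    then have p: "(a, h) \<in> S" "(b, k) \<in> S" "(a, h) \<noteq> (b, k)"
      and meet: "{a<..<a + L * h} \<inter> {b<..<b + L * k} \<noteq> {}"
      using pq unfolding prod.case by blast+
    have pos: "0 < h" "0 < k" using p less.prems(2) by auto
    \<comment> \<open>Two overlapping stacks form one longer stack. Merging does not change the union of the
      stacks and only enlarges that of the extended intervals.\<close>
    define m where "m = min a b"
    define e where "e = max (a + L * h) (b + L * k)"
    define l where "l = (e - m) / L"
    define S' where "S' = insert (m, l) (S - {(a, h), (b, k)})"
    have Ll: "m + L * l = e" using L by (simp add: l_def)
    have "h \<le> l" "k \<le> l"
      using L pos by (auto simp: l_def e_def m_def field_simps)
    then have l: "0 < l" using pos by simp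
    have card: "card S' < card S"
    proof -
      have "card S' \<le> Suc (card (S - {(a, h), (b, k)}))"
        unfolding S'_def by (rule card_insert_le_m1) auto
      also have "card (S - {(a, h), (b, k)}) = card S - 2"
        using p less.prems(1) by (subst card_Diff_subset) auto
      also have "card {(a, h), (b, k)} \<le> card S"
        using p less.prems(1) by (intro card_mono) auto
      then have "Suc (card S - 2) < card S" using p(3) by auto
      finally show ?thesis .
    qed
    have Umerge: "?U (m, l) = ?U (a, h) \<union> ?U (b, k)"
      using meet unfolding prod.case Ll by (auto simp: m_def e_def min_def max_def)
    have U: "(\<Union>p\<in>S'. ?U p) = (\<Union>p\<in>S. ?U p)"
    proof -
      have "(\<Union>p\<in>S'. ?U p) = ?U (m, l) \<union> (\<Union>p\<in>S - {(a, h), (b, k)}. ?U p)"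
        by (simp add: S'_def)
      also have "\<dots> = (\<Union>p\<in>insert (a, h) (insert (b, k) (S - {(a, h), (b, k)})). ?U p)"
        unfolding Umerge by (simp add: Un_assoc)
      also have "insert (a, h) (insert (b, k) (S - {(a, h), (b, k)})) = S" using p by auto
      finally show ?thesis .
    qed
    have "?V (a, h) \<subseteq> ?V (m, l)" "?V (b, k) \<subseteq> ?V (m, l)"
      using \<open>h \<le> l\<close> \<open>k \<le> l\<close> unfolding prod.case Ll by (auto simp: m_def e_def)
    then have V: "(\<Union>p\<in>S. ?V p) \<subseteq> (\<Union>p\<in>S'. ?V p)"
      unfolding S'_def by blast
    have "emeasure lborel (\<Union>p\<in>S. ?V p) \<le> emeasure lborel (\<Union>p\<in>S'. ?V p)"
      using V by (intro emeasure_mono) (auto intro!: sets.finite_UN simp: less.prems S'_def)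
    also have "\<dots> \<le> ennreal ((L + 1) / L) * emeasure lborel (\<Union>p\<in>S'. ?U p)"
      using less.hyps[OF card] less.prems l by (auto simp: S'_def)
    finally show ?thesis unfolding U .
  qed
qed

lemma interval_stacking:
  fixes a h :: "nat \<Rightarrow> real" and L :: real and J :: "nat set"
  assumes h: "\<And>i. i \<in> J \<Longrightarrow> 0 < h i" and L: "0 < L"
  shows "emeasure lborel (\<Union>i\<in>J. {a i - h i<..<a i})
    \<le> ennreal ((L + 1) / L) * emeasure lborel (\<Union>i\<in>J. {a i<..<a i + L * h i})" (is "_ \<le> ?c * ?R")
proof -
  define A where "A n = (\<Union>i\<in>J \<inter> {..<n}. {a i - h i<..<a i})" for n
  have *: "emeasure lborel (A n) \<le> ?c * ?R" for n
  proof -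
    let ?S = "(\<lambda>i. (a i, h i)) ` (J \<inter> {..<n})"
    have "A n \<subseteq> (\<Union>(a, h)\<in>?S. {a - h<..<a + L * h})"
    proof
      fix x assume "x \<in> A n"
      then obtain i where i: "i \<in> J" "i < n" "a i - h i < x" "x < a i" by (auto simp: A_def)
      have "x < a i + L * h i" using i h[of i] L by (smt (verit) mult_pos_pos)
      then show "x \<in> (\<Union>(a, h)\<in>?S. {a - h<..<a + L * h})" using i by auto
    qed
    then have "emeasure lborel (A n) \<le> emeasure lborel (\<Union>(a, h)\<in>?S. {a - h<..<a + L * h})"
      by (intro emeasure_mono) auto
    also have "\<dots> \<le> ?c * emeasure lborel (\<Union>(a, h)\<in>?S. {a<..<a + L * h})"
      using h L by (intro interval_stacking_finite) auto
    also have "\<dots> \<le> ?c * ?R"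
      by (intro mult_left_mono emeasure_mono) auto
    finally show ?thesis .
  qed
  have "(\<Union>i\<in>J. {a i - h i<..<a i}) = (\<Union>n. A n)" by (auto simp: A_def)
  also have "emeasure lborel \<dots> = (SUP n. emeasure lborel (A n))"
    by (intro SUP_emeasure_incseq[symmetric]) (auto simp: incseq_def A_def)
  also have "\<dots> \<le> ?c * ?R" using * by (rule SUP_least)
  finally show ?thesis .
qed

text \<open>
  Fubini along the lines of direction \<open>(u, 1)\<close>: the shear \<open>(y, t) \<mapsto> (y + t u, t)\<close> translates each
  slice of constant \<open>t\<close>, hence preserves volume.
\<close>

lemma emeasure_sheared_slices:
  fixes A :: "('a::euclidean_space \<times> real) set" and u :: 'a
  assumes A: "A \<in> sets borel"
  shows "emeasure lborel A = (\<integral>\<^sup>+y. emeasure lborel {t. (y + t *\<^sub>R u, t) \<in> A} \<partial>lborel)"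
proof -
  have A': "A \<in> sets (lborel \<Otimes>\<^sub>M lborel)" using A by (simp only: lborel_prod sets_lborel)
  have m: "indicator A \<in> borel_measurable (lborel \<Otimes>\<^sub>M lborel :: ('a \<times> real) measure)"
    using A' by simp
  have m2: "(\<lambda>z :: 'a \<times> real. indicator A (fst z + snd z *\<^sub>R u, snd z) :: ennreal)
      \<in> borel_measurable (lborel \<Otimes>\<^sub>M lborel)"
  proof -
    have "(\<lambda>z :: 'a \<times> real. (fst z + snd z *\<^sub>R u, snd z)) \<in> borel_measurable borel"
      by (intro borel_measurable_continuous_onI continuous_intros)
    from measurable_compose[OF this borel_measurable_indicator[of A borel]] A show ?thesis
      by (simp add: lborel_prod)
  qed
  have "emeasure lborel A = emeasure (lborel \<Otimes>\<^sub>M lborel) A" by (simp add: lborel_prod)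
  also have "\<dots> = (\<integral>\<^sup>+z. indicator A z \<partial>(lborel \<Otimes>\<^sub>M lborel))"
    using A' by simp
  also have "\<dots> = (\<integral>\<^sup>+t. \<integral>\<^sup>+y. indicator A (y, t) \<partial>lborel \<partial>lborel)"
    by (rule lborel_pair.nn_integral_snd[OF m, symmetric])
  also have "\<dots> = (\<integral>\<^sup>+t. \<integral>\<^sup>+y. indicator A (y + t *\<^sub>R u, t) \<partial>lborel \<partial>lborel)"
  proof (rule nn_integral_cong)
    fix t :: real
    have s: "(\<lambda>y. indicator A (y, t) :: ennreal) \<in> borel_measurable borel"
    proof -
      have "(\<lambda>y :: 'a. (y, t)) \<in> borel_measurable borel"
        by (intro borel_measurable_continuous_onI continuous_intros)
      from measurable_compose[OF this borel_measurable_indicator[of A borel]] A show ?thesis by simp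
    qed
    have "(\<integral>\<^sup>+y. indicator A (y, t) \<partial>lborel)
        = (\<integral>\<^sup>+y. indicator A (y, t) \<partial>distr lborel borel ((+) (t *\<^sub>R u)))"
      by (simp add: lborel_distr_plus)
    also have "\<dots> = (\<integral>\<^sup>+y. indicator A (t *\<^sub>R u + y, t) \<partial>lborel)"
      by (subst nn_integral_distr) (auto simp: s)
    finally show "(\<integral>\<^sup>+y. indicator A (y, t) \<partial>lborel) = (\<integral>\<^sup>+y. indicator A (y + t *\<^sub>R u, t) \<partial>lborel)"
      by (simp add: add.commute)
  qed
  also have "\<dots> = (\<integral>\<^sup>+y. \<integral>\<^sup>+t. indicator A (y + t *\<^sub>R u, t) \<partial>lborel \<partial>lborel)"
    using lborel_pair.Fubini'[of "\<lambda>y t. indicator A (y + t *\<^sub>R u, t)"] m2 by (simp add: case_prod_beta)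
  also have "\<dots> = (\<integral>\<^sup>+y. emeasure lborel {t. (y + t *\<^sub>R u, t) \<in> A} \<partial>lborel)"
  proof (rule nn_integral_cong)
    fix y :: 'a
    have "(\<lambda>t. (y + t *\<^sub>R u, t)) \<in> borel_measurable borel"
      by (intro borel_measurable_continuous_onI continuous_intros)
    from measurable_sets[OF this A] have "{t. (y + t *\<^sub>R u, t) \<in> A} \<in> sets lborel"
      by (simp add: vimage_def)
    then have "emeasure lborel {t. (y + t *\<^sub>R u, t) \<in> A}
        = (\<integral>\<^sup>+t. indicator {t. (y + t *\<^sub>R u, t) \<in> A} t \<partial>lborel)" by simp
    then show "(\<integral>\<^sup>+t. indicator A (y + t *\<^sub>R u, t) \<partial>lborel)
        = emeasure lborel {t. (y + t *\<^sub>R u, t) \<in> A}" by (simp add: indicator_def)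
  qed
  finally show ?thesis .
qed

text \<open>
  The chord bound for the convex function \<open>s \<mapsto> (1 + c s)\<^sup>k\<close> on \<open>[0, 1]\<close>.
\<close>

lemma power_one_plus_le:
  fixes s c :: real
  assumes "0 \<le> s" "s \<le> 1" "0 \<le> c"
  shows "(1 + c * s) ^ k \<le> 1 + s * ((1 + c) ^ k - 1)"
proof (induction k)
  case (Suc k)
  have "1 \<le> (1 + c) ^ k" using assms by (simp add: one_le_power)
  then have "c * s * (s * ((1 + c) ^ k - 1)) \<le> c * s * (1 * ((1 + c) ^ k - 1))"
    using assms by (intro mult_left_mono mult_right_mono) auto
  then have "(1 + c * s) * (1 + s * ((1 + c) ^ k - 1)) \<le> 1 + s * ((1 + c) ^ Suc k - 1)"
    by (simp add: algebra_simps)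
  moreover have "(1 + c * s) * (1 + c * s) ^ k \<le> (1 + c * s) * (1 + s * ((1 + c) ^ k - 1))"
    using assms Suc by (intro mult_left_mono) auto
  ultimately show ?case by simp
qed simp

section \<open>The weight: mass of balls and doubling\<close>

lemma locally_integrable_measurable:
  assumes "locally_integrable f"
  shows "f \<in> borel_measurable lebesgue"
proof (rule borel_measurable_LIMSEQ_real)
  fix x :: 'a
  show "(\<lambda>n. indicator (cball 0 (real n)) x *\<^sub>R f x) \<longlonglongrightarrow> f x"
  proof (rule tendsto_eventually)
    obtain N where "norm x \<le> real N" using real_arch_simple by blast
    then have "x \<in> cball 0 (real n)" if "n \<ge> N" for n using that by simp
    then show "\<forall>\<^sub>F n in sequentially. indicator (cball 0 (real n)) x *\<^sub>R f x = f x"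
      unfolding eventually_sequentially by (intro exI[of _ N]) auto
  qed
next
  fix n :: nat
  have "f absolutely_integrable_on cball 0 (real n)"
    using assms by (simp add: locally_integrable_def)
  then show "(\<lambda>x. indicator (cball 0 (real n)) x *\<^sub>R f x) \<in> borel_measurable lebesgue"
    unfolding set_integrable_def by (rule borel_measurable_integrable)
qed

lemma locally_integrable_ball_finite:
  assumes "locally_integrable f"
  shows "(\<integral>\<^sup>+x\<in>ball a r. ennreal (f x) \<partial>lebesgue) < \<infinity>"
proof -
  have "integrable lebesgue (\<lambda>x. indicator (cball a r) x *\<^sub>R f x)"
    using assms unfolding locally_integrable_def set_integrable_def[symmetric] by simp
  then have "(\<integral>\<^sup>+x. ennreal (norm (indicator (cball a r) x *\<^sub>R f x)) \<partial>lebesgue) < \<infinity>"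
    by (simp add: integrable_iff_bounded)
  moreover have "(\<integral>\<^sup>+x\<in>ball a r. ennreal (f x) \<partial>lebesgue)
      \<le> (\<integral>\<^sup>+x. ennreal (norm (indicator (cball a r) x *\<^sub>R f x)) \<partial>lebesgue)"
    by (intro nn_integral_mono) (auto simp: indicator_def intro!: ennreal_leI)
  ultimately show ?thesis by (rule le_less_trans[rotated])
qed

definition ball_mass :: "('a::euclidean_space \<Rightarrow> real) \<Rightarrow> 'a \<Rightarrow> real \<Rightarrow> real" where
  "ball_mass w a r = enn2real (\<integral>\<^sup>+x\<in>ball a r. ennreal (w x) \<partial>lebesgue)"

lemma A2_weight_leD:
  assumes "A2_weight_le M w"
  shows "AE x in lebesgue. 0 < w x" "locally_integrable w" "locally_integrable (\<lambda>x. inverse (w x))"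
    "A2_const w \<le> ennreal M"
  using assms by (auto simp: A2_weight_le_def)

lemma ball_mass_nonneg [simp]: "0 \<le> ball_mass w a r"
  by (simp add: ball_mass_def)

lemma nn_integral_ball_mass:
  assumes "locally_integrable w"
  shows "(\<integral>\<^sup>+x\<in>ball a r. ennreal (w x) \<partial>lebesgue) = ennreal (ball_mass w a r)"
  using locally_integrable_ball_finite[OF assms, of a r] by (simp add: ball_mass_def)

lemma ball_mass_mono:
  assumes "locally_integrable w" "r \<le> s"
  shows "ball_mass w a r \<le> ball_mass w a s"
proof -
  have "(\<integral>\<^sup>+x\<in>ball a r. ennreal (w x) \<partial>lebesgue) \<le> (\<integral>\<^sup>+x\<in>ball a s. ennreal (w x) \<partial>lebesgue)"
    using assms(2) by (intro nn_integral_mono) (auto simp: indicator_def)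
  then show ?thesis by (simp add: nn_integral_ball_mass[OF assms(1)])
qed

lemma ball_mass_pos:
  assumes "locally_integrable w" "AE x in lebesgue. 0 < w x" "0 < r"
  shows "0 < ball_mass w a r"
proof (rule ccontr)
  have m: "(\<lambda>x. ennreal (w x)) \<in> borel_measurable lebesgue"
    using locally_integrable_measurable[OF assms(1)] by simp
  assume "\<not> 0 < ball_mass w a r"
  then have "ball_mass w a r = 0" using ball_mass_nonneg[of w a r] by linarith
  then have "(\<integral>\<^sup>+x\<in>ball a r. ennreal (w x) \<partial>lebesgue) = 0"
    using nn_integral_ball_mass[OF assms(1), of a r] by simp
  then have "AE x in lebesgue. ennreal (w x) * indicator (ball a r) x = 0"
    using borel_measurable_times_ennreal[OF m borel_measurable_indicator[of "ball a r"]]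
    by (subst (asm) nn_integral_0_iff_AE) auto
  with assms(2) have "AE x in lebesgue. x \<notin> ball a r"
    by eventually_elim (auto simp: indicator_def split: if_splits)
  then have "ball a r \<in> null_sets lebesgue"
    by (simp add: AE_iff_null_sets)
  then have "emeasure lborel (ball a r) = 0" by (auto dest: null_setsD1)
  moreover have "0 < unit_ball_vol (real DIM('a))" by simp
  ultimately show False using assms(3) by (simp add: emeasure_ball)
qed

text \<open>
  Cauchy-Schwarz for the factors \<open>sqrt w\<close> and \<open>1 / sqrt w\<close>, obtained by integrating the pointwise inequality
  \<open>2 \<le> s w + 1/(s w)\<close>. The choice \<open>s = |B| / w(B)\<close> makes the first term integrate to \<open>|B|\<close>.
\<close>

lemma ball_volume_sq_le:
  fixes a :: "'a::euclidean_space"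
  assumes "locally_integrable w" "locally_integrable (\<lambda>x. inverse (w x))"
    "AE x in lebesgue. 0 < w x" "0 < r"
  shows "(measure lebesgue (ball a r))\<^sup>2 \<le> ball_mass w a r * ball_mass (\<lambda>x. inverse (w x)) a r"
proof -
  let ?A = "ball_mass w a r" and ?B = "ball_mass (\<lambda>x. inverse (w x)) a r"
  let ?V = "measure lebesgue (ball a r)"
  have A: "0 < ?A" using ball_mass_pos assms by blast
  have V: "0 < ?V" using assms(4) by (simp add: content_ball_pos)
  define s where "s = ?V / ?A"
  have s: "0 < s" using A V by (simp add: s_def)
  have m: "(\<lambda>x. ennreal (w x)) \<in> borel_measurable lebesgue"
    "(\<lambda>x. ennreal (inverse (w x))) \<in> borel_measurable lebesgue"
    using locally_integrable_measurable[OF assms(1)] locally_integrable_measurable[OF assms(2)] by auto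
  have m': "(\<lambda>x. ennreal (w x) * indicator (ball a r) x) \<in> borel_measurable lebesgue"
    "(\<lambda>x. ennreal (inverse (w x)) * indicator (ball a r) x) \<in> borel_measurable lebesgue"
    by (intro borel_measurable_times_ennreal m borel_measurable_indicator; simp)+
  have "ennreal (2 * ?V) = 2 * emeasure lebesgue (ball a r)"
    using assms(4) by (simp add: emeasure_ball content_ball ennreal_mult)
  also have "\<dots> = (\<integral>\<^sup>+x. 2 * indicator (ball a r) x \<partial>lebesgue)"
    by (subst nn_integral_cmult_indicator) auto
  also have "\<dots> \<le> (\<integral>\<^sup>+x. ennreal s * (ennreal (w x) * indicator (ball a r) x)
      + ennreal (1 / s) * (ennreal (inverse (w x)) * indicator (ball a r) x) \<partial>lebesgue)"
  proof (rule nn_integral_mono_AE)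
    show "AE x in lebesgue. 2 * indicator (ball a r) x
        \<le> ennreal s * (ennreal (w x) * indicator (ball a r) x)
        + ennreal (1 / s) * (ennreal (inverse (w x)) * indicator (ball a r) x)"
      using assms(3)
    proof eventually_elim
      case (elim x)
      have "0 \<le> (s * w x - 1)\<^sup>2" by simp
      then have "2 * (s * w x) \<le> (s * w x) * (s * w x) + 1"
        by (simp add: power2_eq_square algebra_simps)
      then have "2 \<le> s * w x + 1 / s * inverse (w x)"
        using s elim by (simp add: field_simps)
      then have "ennreal 2 \<le> ennreal (s * w x + 1 / s * inverse (w x))" by (rule ennreal_leI)
      also have "\<dots> = ennreal s * ennreal (w x) + ennreal (1 / s) * ennreal (inverse (w x))"
        using s elim by (simp add: ennreal_plus ennreal_mult[symmetric] del: ennreal_1)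
      finally show ?case by (auto simp: indicator_def)
    qed
  qed
  also have "\<dots> = ennreal s * ennreal ?A + ennreal (1 / s) * ennreal ?B"
    using assms(1,2) m'
    by (simp only: nn_integral_add nn_integral_cmult borel_measurable_times_ennreal
        borel_measurable_const nn_integral_ball_mass)
  also have "\<dots> = ennreal (s * ?A + 1 / s * ?B)"
    using s by (simp add: ennreal_plus ennreal_mult[symmetric])
  finally have "2 * ?V \<le> s * ?A + 1 / s * ?B"
    using s by (subst (asm) ennreal_le_iff) auto
  then have "?V \<le> ?A / ?V * ?B" using A by (simp add: s_def)
  then show ?thesis using V by (simp add: field_simps power2_eq_square)
qed

lemma A2_ball_bound:
  fixes a :: "'a::euclidean_space"
  assumes w: "A2_weight_le M w" and K: "M \<le> K" "0 \<le> K" and r: "0 < r"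
  shows "ball_mass w a r * ball_mass (\<lambda>x. inverse (w x)) a r \<le> K * (measure lebesgue (ball a r))\<^sup>2"
proof -
  note w' = A2_weight_leD[OF w]
  let ?A = "ball_mass w a r" and ?B = "ball_mass (\<lambda>x. inverse (w x)) a r"
  let ?V = "measure lebesgue (ball a r)"
  have V: "0 < ?V" using r by (simp add: content_ball_pos)
  have e: "emeasure lborel (ball a r) = ennreal ?V"
    using r by (simp add: emeasure_ball content_ball)
  have "(ennreal ?A / ennreal ?V) * (ennreal ?B / ennreal ?V) \<le> A2_const w"
    unfolding A2_const_def
    by (rule SUP_upper2[of "(a, r)"]) (use r in \<open>auto simp: nn_integral_ball_mass[OF w'(2)] nn_integral_ball_mass[OF w'(3)] e\<close>)
  also have "\<dots> \<le> ennreal M" by (rule w'(4))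
  also have "\<dots> \<le> ennreal (K)" by (intro ennreal_leI K(1))
  finally have "(?A / ?V) * (?B / ?V) \<le> K"
    using V K(2) by (simp add: divide_ennreal ennreal_mult[symmetric])
  then show ?thesis using V by (simp add: field_simps power2_eq_square)
qed

text \<open>
  For \<open>B' = l B\<close> and the dual weight \<open>w\<^sup>-\<^sup>1\<close>: \<open>w(B') w\<^sup>-\<^sup>1(B) \<le> w(B') w\<^sup>-\<^sup>1(B') \<le> K |B'|\<^sup>2\<close> by \<open>A\<^sub>2\<close>,
  while \<open>|B|\<^sup>2 \<le> w(B) w\<^sup>-\<^sup>1(B)\<close>; dividing by \<open>w\<^sup>-\<^sup>1(B)\<close> gives doubling.
\<close>

lemma A2_doubling:
  fixes a :: "'a::euclidean_space"
  assumes w: "A2_weight_le M w" and K: "M \<le> K" "0 \<le> K" and r: "0 < r" and l: "1 \<le> l"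
  shows "ball_mass w a (l * r) \<le> K * (l ^ DIM('a))\<^sup>2 * ball_mass w a r"
proof -
  note w' = A2_weight_leD[OF w]
  let ?i = "\<lambda>x. inverse (w x)"
  let ?V = "measure lebesgue (ball a r)" and ?W = "measure lebesgue (ball a (l * r))"
  have lr: "0 < l * r" "r \<le> l * r" using r l by auto
  have V: "0 < ?V" using r by (simp add: content_ball_pos)
  have W: "?W = l ^ DIM('a) * ?V"
    using r l by (simp add: content_ball power_mult_distrib)
  have B: "0 < ball_mass ?i a r"
    using w' r by (intro ball_mass_pos) auto
  have "ball_mass w a (l * r) * ball_mass ?i a r \<le> ball_mass w a (l * r) * ball_mass ?i a (l * r)"
    using ball_mass_mono[OF w'(3) lr(2)] by (intro mult_left_mono) auto
  also have "\<dots> \<le> K * ?W\<^sup>2" by (rule A2_ball_bound[OF w K lr(1)])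
  also have "\<dots> = K * (l ^ DIM('a))\<^sup>2 * ?V\<^sup>2" unfolding W by (simp add: power_mult_distrib)
  also have "\<dots> \<le> K * (l ^ DIM('a))\<^sup>2 * (ball_mass w a r * ball_mass ?i a r)"
    using K(2) ball_volume_sq_le[OF w'(2,3,1) r, of a] by (intro mult_left_mono) auto
  finally show ?thesis using B by (simp add: mult.assoc[symmetric])
qed

section \<open>Fubini for the weighted measure\<close>

lemma fst_vimage_null_sets:
  assumes "N \<in> null_sets (lborel :: 'a::euclidean_space measure)"
  shows "fst -` N \<in> null_sets (lborel :: ('a \<times> 'b::euclidean_space) measure)"
proof -
  have "N \<times> UNIV \<in> null_sets (lborel \<Otimes>\<^sub>M (lborel :: 'b measure))"
    using assms lborel.emeasure_pair_measure_Times[of N lborel UNIV]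
    by (auto simp: null_sets_def intro!: pair_measureI)
  moreover have "fst -` N = N \<times> (UNIV :: 'b set)" by auto
  ultimately show ?thesis by (simp add: lborel_prod)
qed

lemma fst_measurable_lebesgue:
  "(fst :: 'a::euclidean_space \<times> 'b::euclidean_space \<Rightarrow> 'a) \<in> lebesgue \<rightarrow>\<^sub>M lebesgue"
proof (rule completion.measurable_completion2)
  show fst: "(fst :: 'a \<times> 'b \<Rightarrow> 'a) \<in> lebesgue \<rightarrow>\<^sub>M lborel"
    by (rule measurable_completion) (simp add: borel_measurable_continuous_onI continuous_on_fst)
  show "null_sets lborel \<subseteq> null_sets (distr lebesgue lborel (fst :: 'a \<times> 'b \<Rightarrow> 'a))"
  proof
    fix A :: "'a set" assume A: "A \<in> null_sets lborel"
    have "fst -` A \<in> null_sets (lborel :: ('a \<times> 'b) measure)" by (rule fst_vimage_null_sets[OF A])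
    then show "A \<in> null_sets (distr lebesgue lborel (fst :: 'a \<times> 'b \<Rightarrow> 'a))"
      using A fst by (auto simp: null_sets_def emeasure_distr)
  qed
qed

lemma sets_weighted_measure [simp]: "sets (weighted_measure w) = sets lebesgue"
  by (simp add: weighted_measure_def)

lemma weight_measurable:
  assumes "locally_integrable w"
  shows "(\<lambda>(x, y, t). ennreal (w x)) \<in> borel_measurable (lebesgue :: ('n::finite, 'm::finite) point measure)"
proof -
  have "(\<lambda>z :: ('n, 'm) point. ennreal (w (fst z))) \<in> borel_measurable lebesgue"
    using measurable_compose[OF fst_measurable_lebesgue, of "\<lambda>x. ennreal (w x)" borel]
      locally_integrable_measurable[OF assms] by auto
  then show ?thesis by (simp add: case_prod_beta)
qed

text \<open>
  Lebesgue measure on the product is the completion of the product of the Lebesgue measures, to which Fubini does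
  not apply directly. The density \<open>w\<close> is therefore replaced by a Borel function that agrees with it
  almost everywhere; \<open>fst_vimage_null_sets\<close> lifts this agreement to the product space.
\<close>

lemma emeasure_weighted_measure_slices:
  fixes A :: "('n::finite, 'm::finite) point set"
  assumes w: "locally_integrable w" and A: "A \<in> sets borel"
  shows "emeasure (weighted_measure w) A
    = (\<integral>\<^sup>+x. ennreal (w x) * emeasure lborel {p. (x, p) \<in> A} \<partial>lebesgue)"
proof -
  obtain g where g: "g \<in> borel_measurable lborel" "AE x in lborel. ennreal (w x) = g x"
    using completion_ex_borel_measurable[of "\<lambda>x. ennreal (w x)" lborel]
      locally_integrable_measurable[OF w] by auto
  have A': "A \<in> sets (lborel \<Otimes>\<^sub>M lborel)" using A by (simp only: lborel_prod sets_lborel)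
  obtain N where N: "N \<in> null_sets lborel" "{x. ennreal (w x) \<noteq> g x} \<subseteq> N"
    using g(2) by (auto simp: eventually_ae_filter)
  have AE: "AE z :: ('n, 'm) point in lborel. ennreal (w (fst z)) = g (fst z)"
    by (rule AE_I'[OF fst_vimage_null_sets[OF N(1)]]) (use N(2) in auto)
  have "emeasure (weighted_measure w) A
      = (\<integral>\<^sup>+z. (case z of (x, y, t) \<Rightarrow> ennreal (w x)) * indicator A z \<partial>lebesgue)"
    unfolding weighted_measure_def
    by (rule emeasure_density[OF weight_measurable[OF w]]) (use A in simp)
  also have "\<dots> = (\<integral>\<^sup>+z. g (fst z) * indicator A z \<partial>(lborel \<Otimes>\<^sub>M lborel))"
    unfolding nn_integral_completion lborel_prod
    by (intro nn_integral_cong_AE) (use AE in eventually_elim, auto)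
  also have "\<dots> = (\<integral>\<^sup>+x. \<integral>\<^sup>+p. g (fst (x, p)) * indicator A (x, p) \<partial>lborel \<partial>lborel)"
    using A' g(1) by (intro lborel.nn_integral_fst[symmetric]) (measurable, auto)
  also have "\<dots> = (\<integral>\<^sup>+x. g x * emeasure lborel {p. (x, p) \<in> A} \<partial>lborel)"
  proof (rule nn_integral_cong)
    fix x :: "real ^ 'n"
    have "Pair x -` A \<in> sets lborel" using A' by (rule sets_Pair1)
    moreover have "(\<integral>\<^sup>+p. g x * indicator A (x, p) \<partial>lborel)
        = (\<integral>\<^sup>+p. g x * indicator (Pair x -` A) p \<partial>lborel)"
      by (intro nn_integral_cong) (auto simp: indicator_def)
    ultimately have "(\<integral>\<^sup>+p. g x * indicator A (x, p) \<partial>lborel) = g x * emeasure lborel (Pair x -` A)"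
      by (simp only: nn_integral_cmult_indicator)
    then show "(\<integral>\<^sup>+p. g (fst (x, p)) * indicator A (x, p) \<partial>lborel)
        = g x * emeasure lborel {p. (x, p) \<in> A}"
      by (simp add: vimage_def)
  qed
  also have "\<dots> = (\<integral>\<^sup>+x. ennreal (w x) * emeasure lborel {p. (x, p) \<in> A} \<partial>lebesgue)"
    unfolding nn_integral_completion
    by (intro nn_integral_cong_AE) (use g(2) in eventually_elim, auto)
  finally show ?thesis .
qed

section \<open>Tubes around free trajectories\<close>

text \<open>
  Cylinders, forward stacks, enlargements and neighbourhoods of the reference cylinder are all of this
  form: a ball in \<open>x\<close>, a ball in \<open>y\<close> that drifts with constant velocity \<open>u\<close>, and a set of
  times. One formula for the measure, \<open>measure_tube\<close>, serves for all of them.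
\<close>

definition tube ::
  "real ^ 'n \<Rightarrow> real \<Rightarrow> real ^ 'm \<Rightarrow> real ^ 'm \<Rightarrow> real \<Rightarrow> real set \<Rightarrow> ('n::finite, 'm::finite) point set" where
  "tube a r b u \<rho> I = {(x, y, t). norm (x - a) < r \<and> norm (y - b - t *\<^sub>R u) < \<rho> \<and> t \<in> I}"

lemma in_tube: "(x, y, t) \<in> tube a r b u \<rho> I
    \<longleftrightarrow> norm (x - a) < r \<and> norm (y - b - t *\<^sub>R u) < \<rho> \<and> t \<in> I"
  by (simp add: tube_def)

lemma tube_alt: "tube a r b u \<rho> I =
    {z. norm (fst z - a) < r} \<inter> {z. norm (fst (snd z) - b - snd (snd z) *\<^sub>R u) < \<rho>} \<inter> (\<lambda>z. snd (snd z)) -` I"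
  by (auto simp: tube_def)

lemma open_tube: "open I \<Longrightarrow> open (tube a r b u \<rho> I)"
  unfolding tube_alt
  by (intro open_Int open_Collect_less open_vimage continuous_intros)

lemma tube_borel:
  fixes a :: "real ^ 'n::finite" and b :: "real ^ 'm::finite"
  assumes "I \<in> sets borel" shows "tube a r b u \<rho> I \<in> sets borel"
proof -
  have "(\<lambda>z :: ('n, 'm) point. snd (snd z)) \<in> borel_measurable borel"
    by (intro borel_measurable_continuous_onI continuous_intros)
  from measurable_sets[OF this assms] have "(\<lambda>z :: ('n, 'm) point. snd (snd z)) -` I \<in> sets borel"
    by simp
  moreover have "{z :: ('n, 'm) point. norm (fst z - a) < r} \<in> sets borel"
    "{z :: ('n, 'm) point. norm (fst (snd z) - b - snd (snd z) *\<^sub>R u) < \<rho>} \<in> sets borel"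
    by (intro borel_open open_Collect_less continuous_intros)+
  ultimately show ?thesis unfolding tube_alt by (simp only: sets.Int)
qed

lemma slice_borel:
  fixes A :: "('a::euclidean_space \<times> 'b::euclidean_space) set"
  assumes "A \<in> sets borel" shows "{p. (x, p) \<in> A} \<in> sets borel"
proof -
  have "(\<lambda>p :: 'b. (x, p)) \<in> borel_measurable borel"
    by (intro borel_measurable_continuous_onI continuous_intros)
  from measurable_sets[OF this assms] show ?thesis by (simp add: vimage_def)
qed

lemma emeasure_tube:
  fixes a :: "real ^ 'n" and b :: "real ^ 'm::finite"
  assumes w: "locally_integrable w" and I: "I \<in> sets borel" and \<rho>: "0 \<le> \<rho>"
  shows "emeasure (weighted_measure w) (tube a r b u \<rho> I)
    = ennreal (ball_mass w a r * (unit_ball_vol (real CARD('m)) * \<rho> ^ CARD('m))) * emeasure lborel I"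
proof -
  let ?k = "ennreal (unit_ball_vol (real CARD('m)) * \<rho> ^ CARD('m))"
  have slice: "emeasure lborel {p. (x, p) \<in> tube a r b u \<rho> I}
      = indicator (ball a r) x * (?k * emeasure lborel I)" for x
  proof -
    have m: "{p. (x, p) \<in> tube a r b u \<rho> I} \<in> sets borel"
      by (rule slice_borel[OF tube_borel[OF I]])
    have "emeasure lborel {p. (x, p) \<in> tube a r b u \<rho> I}
        = (\<integral>\<^sup>+y. emeasure lborel {t. (y + t *\<^sub>R u, t) \<in> {p. (x, p) \<in> tube a r b u \<rho> I}} \<partial>lborel)"
      by (rule emeasure_sheared_slices[OF m])
    also have "\<dots> = (\<integral>\<^sup>+y. (indicator (ball a r) x * emeasure lborel I) * indicator (ball b \<rho>) y \<partial>lborel)"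
    proof (rule nn_integral_cong)
      fix y :: "real ^ 'm"
      have "{t. (y + t *\<^sub>R u, t) \<in> {p. (x, p) \<in> tube a r b u \<rho> I}}
          = (if x \<in> ball a r \<and> y \<in> ball b \<rho> then I else {})"
        by (auto simp: in_tube dist_norm norm_minus_commute algebra_simps)
      then show "emeasure lborel {t. (y + t *\<^sub>R u, t) \<in> {p. (x, p) \<in> tube a r b u \<rho> I}}
          = (indicator (ball a r) x * emeasure lborel I) * indicator (ball b \<rho>) y"
        by (auto simp: indicator_def)
    qed
    also have "\<dots> = (indicator (ball a r) x * emeasure lborel I) * emeasure lborel (ball b \<rho>)"
      by (rule nn_integral_cmult_indicator) simp
    finally show ?thesis using \<rho> by (simp add: emeasure_ball ac_simps)
  qed
  have "emeasure (weighted_measure w) (tube a r b u \<rho> I)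
      = (\<integral>\<^sup>+x. (ennreal (w x) * indicator (ball a r) x) * (?k * emeasure lborel I) \<partial>lebesgue)"
    unfolding emeasure_weighted_measure_slices[OF w tube_borel[OF I]] slice by (simp add: ac_simps)
  also have "\<dots> = ennreal (ball_mass w a r) * (?k * emeasure lborel I)"
    using borel_measurable_times_ennreal[OF _ borel_measurable_indicator[of "ball a r"], of "\<lambda>x. ennreal (w x)" lebesgue]
      locally_integrable_measurable[OF w]
    by (subst nn_integral_multc) (auto simp: nn_integral_ball_mass[OF w])
  finally show ?thesis using \<rho> by (simp add: ennreal_mult ac_simps)
qed

lemma measure_tube:
  fixes a :: "real ^ 'n" and b :: "real ^ 'm::finite"
  assumes "locally_integrable w" and "0 \<le> \<rho>" and "s \<le> t"
  shows "emeasure (weighted_measure w) (tube a r b u \<rho> {s<..<t})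
      = ennreal (ball_mass w a r * (unit_ball_vol (real CARD('m)) * \<rho> ^ CARD('m)) * (t - s))" (is ?e)
    and "measure (weighted_measure w) (tube a r b u \<rho> {s<..<t})
      = ball_mass w a r * (unit_ball_vol (real CARD('m)) * \<rho> ^ CARD('m)) * (t - s)" (is ?m)
proof -
  show ?e using assms by (simp add: emeasure_tube ennreal_mult)
  then show ?m using assms by (simp add: measure_def)
qed

text \<open>
  The boundary is null slice by slice: for \<open>x\<close> off the sphere, almost every line of direction
  \<open>(u, 1)\<close> misses the lateral boundary and meets the rest in at most two points.
\<close>

lemma tube_boundary_null:
  fixes a :: "real ^ 'n" and b :: "real ^ 'm::finite"
  assumes w: "locally_integrable w"
  shows "{(x, y, t). norm (x - a) = r \<or> norm (y - b - t *\<^sub>R u) = \<rho> \<or> t = s1 \<or> t = s2}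
    \<in> null_sets (weighted_measure w)" (is "?N \<in> _")
proof -
  have sphere: "AE x :: 'c::euclidean_space in lborel. norm (x - c) \<noteq> d" for c d
  proof -
    have "sphere c d \<in> null_sets lebesgue"
      using negligible_sphere[of c d] by (simp add: negligible_iff_null_sets)
    then have "AE x in lebesgue. x \<notin> sphere c d" by (rule AE_not_in)
    then have "AE x in lborel. x \<notin> sphere c d" by (simp add: AE_completion_iff)
    then show ?thesis by eventually_elim (simp add: dist_norm norm_minus_commute)
  qed
  have "closed ?N"
  proof -
    have "?N = {z. norm (fst z - a) = r} \<union> {z. norm (fst (snd z) - b - snd (snd z) *\<^sub>R u) = \<rho>}
        \<union> {z. snd (snd z) = s1} \<union> {z. snd (snd z) = s2}" by auto
    also have "closed \<dots>" by (intro closed_Un closed_Collect_eq continuous_intros)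
    finally show ?thesis .
  qed
  then have N: "?N \<in> sets borel" by (rule borel_closed)
  have slice: "emeasure lborel {p. (x, p) \<in> ?N} = 0" if "norm (x - a) \<noteq> r" for x
  proof -
    have m: "{p. (x, p) \<in> ?N} \<in> sets borel" by (rule slice_borel[OF N])
    have "emeasure lborel {p. (x, p) \<in> ?N}
        = (\<integral>\<^sup>+y. emeasure lborel {t. (y + t *\<^sub>R u, t) \<in> {p. (x, p) \<in> ?N}} \<partial>lborel)"
      by (rule emeasure_sheared_slices[OF m])
    also have "\<dots> = (\<integral>\<^sup>+y. 0 \<partial>(lborel :: (real ^ 'm) measure))"
    proof (rule nn_integral_cong_AE)
      show "AE y in lborel. emeasure lborel {t. (y + t *\<^sub>R u, t) \<in> {p. (x, p) \<in> ?N}} = 0"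
        using sphere[of b \<rho>]
      proof eventually_elim
        case (elim y)
        then have "{t. (y + t *\<^sub>R u, t) \<in> {p. (x, p) \<in> ?N}} = {s1, s2}"
          using that by (auto simp: algebra_simps)
        then show ?case by (simp add: emeasure_lborel_countable)
      qed
    qed
    finally show ?thesis by simp
  qed
  have "emeasure (weighted_measure w) ?N = (\<integral>\<^sup>+x. 0 \<partial>(lebesgue :: (real ^ 'n) measure))"
    unfolding emeasure_weighted_measure_slices[OF w N]
  proof (intro nn_integral_cong_AE AE_completion)
    show "AE x in lborel. ennreal (w x) * emeasure lborel {p. (x, p) \<in> ?N} = 0"
      using sphere[of a r]
    proof eventually_elim
      case (elim x)
      show ?case unfolding slice[OF elim] by simp
    qed
  qed
  then show ?thesis using N by (auto simp: null_sets_def)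
qed

section \<open>Geometry of intrinsic cylinders\<close>

lemma velocity_diff: "velocity \<iota> (x - y) = velocity \<iota> x - velocity \<iota> y"
  by (simp add: velocity_def vec_eq_iff)

lemma velocity_add_scale: "velocity \<iota> (x + s *\<^sub>R y) = velocity \<iota> x + s *\<^sub>R velocity \<iota> y"
  by (simp add: velocity_def vec_eq_iff)

lemma norm_velocity_le:
  fixes \<iota> :: "'m::finite \<Rightarrow> 'n::finite"
  assumes "inj \<iota>"
  shows "norm (velocity \<iota> x) \<le> norm x"
proof -
  have "(\<Sum>i\<in>UNIV. (x $ \<iota> i)\<^sup>2) = (\<Sum>j\<in>range \<iota>. (x $ j)\<^sup>2)"
    using assms by (simp add: sum.reindex)
  also have "\<dots> \<le> (\<Sum>j\<in>UNIV. (x $ j)\<^sup>2)" by (rule sum_mono2) auto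
  finally show ?thesis
    by (simp add: norm_vec_def L2_set_def velocity_def)
qed

lemma velocity_lipschitz:
  fixes \<iota> :: "'m::finite \<Rightarrow> 'n::finite"
  assumes "inj \<iota>"
  shows "norm (velocity \<iota> x - velocity \<iota> y) \<le> norm (x - y)"
  using norm_velocity_le[OF assms, of "x - y"] by (simp add: velocity_diff)

lemma cylinder_tube: "cylinder \<iota> r (xP, yP, tP)
    = tube xP r (yP - tP *\<^sub>R velocity \<iota> xP) (velocity \<iota> xP) (r ^ 3) {tP - r\<^sup>2<..<tP}"
  by (auto simp: tube_def algebra_simps)

lemma forward_stack_tube: "forward_stack \<iota> L r (xP, yP, tP)
    = tube xP r (yP - tP *\<^sub>R velocity \<iota> xP) (velocity \<iota> xP) ((real L + 2) * r ^ 3) {tP<..<tP + real L * r\<^sup>2}"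
  by (auto simp: tube_def algebra_simps)

text \<open>
  It is scaled by three about the top centre and two-sided in time, since the cylinders that it has to contain
  may reach beyond \<open>t\<^sub>P\<close>.
\<close>

fun enlarged_cylinder ::
  "('m::finite \<Rightarrow> 'n::finite) \<Rightarrow> real \<Rightarrow> ('n, 'm) point \<Rightarrow> ('n, 'm) point set" where
  "enlarged_cylinder \<iota> r (xP, yP, tP) = tube xP (3 * r) (yP - tP *\<^sub>R velocity \<iota> xP) (velocity \<iota> xP)
     ((3 * r) ^ 3) {tP - (3 * r)\<^sup>2<..<tP + (3 * r)\<^sup>2}"

lemma open_cylinder: "open (cylinder \<iota> r P)"
  by (cases P) (simp only: cylinder_tube open_tube open_greaterThanLessThan)

lemma open_forward_stack: "open (forward_stack \<iota> L r P)"
  by (cases P) (simp only: forward_stack_tube open_tube open_greaterThanLessThan)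

lemma open_enlarged_cylinder: "open (enlarged_cylinder \<iota> r P)"
  by (cases P) (simp only: enlarged_cylinder.simps open_tube open_greaterThanLessThan)

lemma cylinder_subset_enlarged:
  assumes "0 < r"
  shows "cylinder \<iota> r P \<subseteq> enlarged_cylinder \<iota> r P"
proof (cases P)
  case (fields xP yP tP)
  have le: "r \<le> 3 * r" "r ^ 3 \<le> (3 * r) ^ 3" "r\<^sup>2 \<le> (3 * r)\<^sup>2" "0 < (3 * r)\<^sup>2"
    using assms by (auto simp: power_mult_distrib)
  show ?thesis
  proof
    fix z assume "z \<in> cylinder \<iota> r P"
    then show "z \<in> enlarged_cylinder \<iota> r P"
      using le by (cases z) (simp only: fields cylinder_tube enlarged_cylinder.simps in_tube
          greaterThanLessThan_iff, linarith)
  qed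
qed

text \<open>
  The \<open>y\<close>-estimate is the kinetic one: the two cylinders drift with velocities that
  differ by less than \<open>r + s\<close>, over times shorter than \<open>s\<^sup>2\<close>, so the mismatch of the drifts is of
  order \<open>r\<^sup>3\<close>, the size of the cylinders themselves.
\<close>

lemma meeting_cylinder_subset_enlarged:
  fixes \<iota> :: "'m::finite \<Rightarrow> 'n::finite"
  assumes \<iota>: "inj \<iota>" and s: "0 < s" "s \<le> r"
    and meet: "cylinder \<iota> r P \<inter> cylinder \<iota> s P' \<noteq> {}"
  shows "cylinder \<iota> s P' \<subseteq> enlarged_cylinder \<iota> r P"
proof
  obtain a b c where P: "P = (a, b, c)" by (cases P)
  obtain a' b' c' where P': "P' = (a', b', c')" by (cases P')
  obtain x0 y0 t0 where z0: "(x0, y0, t0) \<in> cylinder \<iota> r P" "(x0, y0, t0) \<in> cylinder \<iota> s P'"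
    using meet by auto
  fix z assume z: "z \<in> cylinder \<iota> s P'"
  obtain x y t where zz: "z = (x, y, t)" by (cases z)
  define v where "v = velocity \<iota> a"
  define v' where "v' = velocity \<iota> a'"
  have 0: "norm (x0 - a) < r" "norm (y0 - b - (t0 - c) *\<^sub>R v) < r ^ 3" "c - r\<^sup>2 < t0" "t0 < c"
    "norm (x0 - a') < s" "norm (y0 - b' - (t0 - c') *\<^sub>R v') < s ^ 3" "c' - s\<^sup>2 < t0" "t0 < c'"
    using z0 unfolding P P' v_def v'_def by auto
  have 1: "norm (x - a') < s" "norm (y - b' - (t - c') *\<^sub>R v') < s ^ 3" "c' - s\<^sup>2 < t" "t < c'"
    using z unfolding P' zz v'_def by auto
  have r: "0 < r" using s by simp
  have s2: "s\<^sup>2 \<le> r\<^sup>2" and s3: "s ^ 3 \<le> r ^ 3" using s by (auto intro: power_mono)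
  have aa: "norm (a' - a) < s + r"
    using norm_triangle_ineq[of "a' - x0" "x0 - a"] 0(1,5) by (simp add: norm_minus_commute)
  have "norm (x - a) \<le> norm (x - a') + norm (a' - a)"
    using norm_triangle_ineq[of "x - a'" "a' - a"] by simp
  then have X: "norm (x - a) < 3 * r" using aa 1(1) s by linarith
  have T: "c - (3 * r)\<^sup>2 < t" "t < c + (3 * r)\<^sup>2"
    using 0 1 s2 r by (auto simp: power_mult_distrib)
  have dt: "\<bar>t - t0\<bar> < s\<^sup>2" using 0 1 by auto
  have dv: "norm (v' - v) < s + r"
    using velocity_lipschitz[OF \<iota>, of a' a] aa by (simp add: v_def v'_def)
  have drift: "norm ((t - t0) *\<^sub>R (v' - v)) \<le> r\<^sup>2 * (2 * r)"
  proof -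
    have "\<bar>t - t0\<bar> * norm (v' - v) \<le> r\<^sup>2 * (2 * r)"
      using dt dv s2 s r norm_ge_zero[of "v' - v"] by (intro mult_mono) linarith+
    then show ?thesis by simp
  qed
  have "y - b - (t - c) *\<^sub>R v = (y - b' - (t - c') *\<^sub>R v') - (y0 - b' - (t0 - c') *\<^sub>R v')
      + (y0 - b - (t0 - c) *\<^sub>R v) + (t - t0) *\<^sub>R (v' - v)"
    by (simp add: algebra_simps)
  also have "norm \<dots> \<le> norm (y - b' - (t - c') *\<^sub>R v') + norm (y0 - b' - (t0 - c') *\<^sub>R v')
      + norm (y0 - b - (t0 - c) *\<^sub>R v) + norm ((t - t0) *\<^sub>R (v' - v))"
    using norm_triangle_ineq norm_triangle_ineq4 by (smt (verit))
  also have "\<dots> < s ^ 3 + s ^ 3 + r ^ 3 + r\<^sup>2 * (2 * r)"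
    using 0 1 drift by linarith
  also have "\<dots> \<le> (3 * r) ^ 3"
  proof -
    have "(3 * r) ^ 3 = 27 * r ^ 3" "r\<^sup>2 * (2 * r) = 2 * r ^ 3" "0 < r ^ 3"
      using r by (auto simp: power_mult_distrib power2_eq_square power3_eq_cube)
    then show ?thesis using s3 by linarith
  qed
  finally have Y: "norm (y - b - (t - c) *\<^sub>R v) < (3 * r) ^ 3" .
  show "z \<in> enlarged_cylinder \<iota> r P"
    using X T Y unfolding P zz enlarged_cylinder.simps in_tube v_def by (simp add: algebra_simps)
qed

text \<open>
  From here on cylinders are treated as opaque sets, which the simplifier would otherwise split into
  coordinates.
\<close>

declare cylinder.simps [simp del] forward_stack.simps [simp del] enlarged_cylinder.simps [simp del]

section \<open>Covering by sparsely filled cylinders\<close>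

lemma open_in_weighted_sets:
  "open A \<Longrightarrow> A \<in> sets (weighted_measure w)"
  by simp

lemma enlarged_cylinder_measure_le:
  fixes \<iota> :: "'m::finite \<Rightarrow> 'n::finite"
  assumes w: "A2_weight_le M w" and K: "M \<le> K" "0 \<le> K" and r: "0 < r"
  shows "emeasure (weighted_measure w) (enlarged_cylinder \<iota> r P)
    \<le> ennreal (K * (3 ^ CARD('n))\<^sup>2 * 27 ^ CARD('m) * 18) * emeasure (weighted_measure w) (cylinder \<iota> r P)"
proof (cases P)
  case (fields xP yP tP)
  note weight_integrable = A2_weight_leD(2)[OF w]
  let ?\<omega> = "unit_ball_vol (real CARD('m))" and ?m = "CARD('m)"
  let ?d = "K * (3 ^ CARD('n))\<^sup>2"
  have len: "tP + (3 * r)\<^sup>2 - (tP - (3 * r)\<^sup>2) = 18 * r\<^sup>2" "tP - (tP - r\<^sup>2) = r\<^sup>2"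
    by (auto simp: power_mult_distrib)
  have pow: "((3 * r) ^ 3) ^ ?m = 27 ^ ?m * (r ^ 3) ^ ?m"
    by (simp add: power_mult_distrib)
  have "emeasure (weighted_measure w) (enlarged_cylinder \<iota> r P)
      = ennreal (ball_mass w xP (3 * r) * (?\<omega> * ((3 * r) ^ 3) ^ ?m) * (18 * r\<^sup>2))"
    unfolding fields enlarged_cylinder.simps using r len(1)
    by (subst measure_tube(1)[OF weight_integrable]) auto
  also have "\<dots> \<le> ennreal (?d * 27 ^ ?m * 18 * (ball_mass w xP r * (?\<omega> * (r ^ 3) ^ ?m) * r\<^sup>2))"
  proof (rule ennreal_leI)
    have "ball_mass w xP (3 * r) * (27 ^ ?m * (?\<omega> * (r ^ 3) ^ ?m) * (18 * r\<^sup>2))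
        \<le> ?d * ball_mass w xP r * (27 ^ ?m * (?\<omega> * (r ^ 3) ^ ?m) * (18 * r\<^sup>2))"
      using A2_doubling[OF w K r, of 3 xP] r by (intro mult_right_mono) auto
    then show "ball_mass w xP (3 * r) * (?\<omega> * ((3 * r) ^ 3) ^ ?m) * (18 * r\<^sup>2)
        \<le> ?d * 27 ^ ?m * 18 * (ball_mass w xP r * (?\<omega> * (r ^ 3) ^ ?m) * r\<^sup>2)"
      unfolding pow by (simp only: ac_simps)
  qed
  also have "\<dots> = ennreal (?d * 27 ^ ?m * 18) * emeasure (weighted_measure w) (cylinder \<iota> r P)"
    unfolding fields cylinder_tube using r K(2) len(2)
    by (subst measure_tube(1)[OF weight_integrable]) (auto simp: ennreal_mult)
  finally show ?thesis .
qed

text \<open>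
  The Lindelof property, for indices rather than for sets: the forward stack of a cylinder is attached to
  its centre and radius.
\<close>

lemma countable_subfamily_of_cylinders:
  fixes \<F> :: "(('n::finite, 'm::finite) point \<times> real) set"
  obtains \<G> where "countable \<G>" "\<G> \<subseteq> \<F>"
    "(\<Union>(P, r)\<in>\<F>. cylinder \<iota> r P) = (\<Union>(P, r)\<in>\<G>. cylinder \<iota> r P)"
proof -
  let ?Q = "\<lambda>(P, r). cylinder \<iota> r P"
  have op: "open C" if "C \<in> ?Q ` \<F>" for C
    using that
  proof (rule imageE)
    fix p assume "C = ?Q p"
    then show "open C" by (cases p) (simp only: prod.case open_cylinder)
  qed
  obtain \<C> where \<C>: "\<C> \<subseteq> ?Q ` \<F>" "countable \<C>" "\<Union>\<C> = \<Union>(?Q ` \<F>)"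
    by (rule Lindelof[of "?Q ` \<F>", OF op]) (assumption, rule that)
  from \<C>(1,2) have "\<exists>\<G>. countable \<G> \<and> \<G> \<subseteq> \<F> \<and> \<C> = ?Q ` \<G>"
    unfolding countable_subset_image[symmetric] by (rule conjI[rotated])
  then obtain \<G> where \<G>: "countable \<G>" "\<G> \<subseteq> \<F>" "\<C> = ?Q ` \<G>"
    by (elim exE conjE) (rule that)
  have "(\<Union>p\<in>\<F>. ?Q p) = (\<Union>p\<in>\<G>. ?Q p)" using \<C>(3) unfolding \<G>(3) by (rule sym)
  with \<G>(1,2) show ?thesis by (rule that)
qed

text \<open>
  A union of cylinders, each of which leaves at least a quarter of its measure to the complement of \<open>E\<close>, is controlled
  by the part of that complement which it covers. For finite families this is the Vitali selection: the
  enlargements of disjoint cylinders cover the union, and the quarters are disjoint. The general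
  case follows by Lindelof and monotone convergence.
\<close>

lemma covering_lemma:
  fixes \<iota> :: "'m::finite \<Rightarrow> 'n::finite" and \<F> :: "(('n, 'm) point \<times> real) set" and w D
  defines "\<mu> \<equiv> weighted_measure w :: ('n, 'm) point measure"
  assumes \<iota>: "inj \<iota>"
    and D: "\<And>P r. 0 < r \<Longrightarrow>
      emeasure \<mu> (enlarged_cylinder \<iota> r P) \<le> ennreal D * emeasure \<mu> (cylinder \<iota> r P)"
    and E: "E \<in> sets \<mu>" and W: "W \<in> sets \<mu>"
    and pos: "\<And>P r. (P, r) \<in> \<F> \<Longrightarrow> 0 < r"
    and sub: "\<And>P r. (P, r) \<in> \<F> \<Longrightarrow> cylinder \<iota> r P \<subseteq> W"
    and sparse: "\<And>P r. (P, r) \<in> \<F> \<Longrightarrow>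
      emeasure \<mu> (cylinder \<iota> r P) \<le> 4 * emeasure \<mu> (cylinder \<iota> r P - E)"
  shows "emeasure \<mu> (\<Union>(P, r)\<in>\<F>. cylinder \<iota> r P) \<le> ennreal (4 * D) * emeasure \<mu> (W - E)"
proof -
  let ?Q = "\<lambda>(P, r). cylinder \<iota> r P" and ?Q' = "\<lambda>(P, r). enlarged_cylinder \<iota> r P"
  have Q: "?Q p \<in> sets \<mu>" "?Q' p \<in> sets \<mu>" for p
    unfolding \<mu>_def case_prod_beta
    by (rule open_in_weighted_sets[OF open_cylinder] open_in_weighted_sets[OF open_enlarged_cylinder])+
  have fin: "emeasure \<mu> (\<Union>p\<in>I. ?Q p) \<le> ennreal (4 * D) * emeasure \<mu> (W - E)"
    if I: "finite I" "I \<subseteq> \<F>" for I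
  proof -
    obtain J where J: "J \<subseteq> I" "disjoint_family_on ?Q J" "(\<Union>p\<in>I. ?Q p) \<subseteq> (\<Union>p\<in>J. ?Q' p)"
    proof -
      have "\<exists>J\<subseteq>I. disjoint_family_on ?Q J \<and> (\<Union>p\<in>I. ?Q p) \<subseteq> (\<Union>p\<in>J. ?Q' p)"
      proof (rule finite_vitali_selection[OF I(1), of snd])
        fix p q assume *: "p \<in> I" "q \<in> I" "snd q \<le> snd p" "?Q p \<inter> ?Q q \<noteq> {}"
        obtain P r P' s where pq: "p = (P, r)" "q = (P', s)" by (meson surj_pair)
        have "0 < s" using *(2) I(2) pos pq by blast
        then show "?Q q \<subseteq> ?Q' p"
          using meeting_cylinder_subset_enlarged[OF \<iota>, of s r P P'] *(3,4)
          unfolding pq prod.case snd_conv by blast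
      next
        fix p assume "p \<in> I"
        then show "?Q p \<subseteq> ?Q' p"
          using I(2) pos cylinder_subset_enlarged by (cases p) blast
      qed
      then show ?thesis using that by blast
    qed
    have fJ: "finite J" "J \<subseteq> \<F>" using J(1) I finite_subset by auto
    have dJ: "disjoint_family_on (\<lambda>p. ?Q p - E) J"
      using J(2) unfolding disjoint_family_on_def by blast
    have mJ: "(\<lambda>p. ?Q p - E) ` J \<subseteq> sets \<mu>"
      using Q(1) E by blast
    have "emeasure \<mu> (\<Union>p\<in>I. ?Q p) \<le> emeasure \<mu> (\<Union>p\<in>J. ?Q' p)"
      using J(3) Q fJ by (intro emeasure_mono sets.finite_UN) auto
    also have "\<dots> \<le> (\<Sum>p\<in>J. emeasure \<mu> (?Q' p))"
      using Q fJ by (intro emeasure_subadditive_finite) auto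
    also have "\<dots> \<le> (\<Sum>p\<in>J. ennreal (4 * D) * emeasure \<mu> (?Q p - E))"
    proof (rule sum_mono)
      fix p assume "p \<in> J"
      then obtain P r where p: "p = (P, r)" "(P, r) \<in> \<F>" using fJ by (cases p) auto
      have "emeasure \<mu> (?Q' p) \<le> ennreal D * emeasure \<mu> (?Q p)" using D pos p by auto
      also have "\<dots> \<le> ennreal D * (4 * emeasure \<mu> (?Q p - E))"
        using sparse[OF p(2)] p by (intro mult_left_mono) auto
      also have "\<dots> = ennreal (4 * D) * emeasure \<mu> (?Q p - E)"
      proof -
        have "ennreal (4 * D) = 4 * ennreal D" by (simp add: ennreal_mult')
        then show ?thesis by (simp add: p ac_simps)
      qed
      finally show "emeasure \<mu> (?Q' p) \<le> ennreal (4 * D) * emeasure \<mu> (?Q p - E)" .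
    qed
    also have "\<dots> = ennreal (4 * D) * emeasure \<mu> (\<Union>p\<in>J. ?Q p - E)"
      unfolding sum_distrib_left[symmetric] sum_emeasure[OF mJ dJ fJ(1)] ..
    also have "\<dots> \<le> ennreal (4 * D) * emeasure \<mu> (W - E)"
    proof (intro mult_left_mono emeasure_mono UN_least)
      fix p assume "p \<in> J"
      then obtain P r where p: "p = (P, r)" "(P, r) \<in> \<F>" using fJ by (cases p) auto
      show "?Q p - E \<subseteq> W - E" using sub[OF p(2)] unfolding p(1) by blast
    qed (use W E in auto)
    finally show ?thesis .
  qed
  obtain \<G> where \<G>: "countable \<G>" "\<G> \<subseteq> \<F>"
    and U: "(\<Union>p\<in>\<F>. ?Q p) = (\<Union>p\<in>\<G>. ?Q p)"
    by (rule countable_subfamily_of_cylinders)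
  show ?thesis
  proof (cases "\<G> = {}")
    case True
    then show ?thesis unfolding U by simp
  next
    case False
    define q where "q i = ?Q (from_nat_into \<G> i)" for i
    define A where "A n = (\<Union>i<n. q i)" for n
    have A: "range A \<subseteq> sets \<mu>"
      unfolding A_def q_def by (intro image_subsetI sets.finite_UN finite_lessThan Q(1))
    have "\<G> = range (from_nat_into \<G>)" by (rule range_from_nat_into[OF False \<G>(1), symmetric])
    then have "(\<Union>p\<in>\<G>. ?Q p) = (\<Union>p\<in>range (from_nat_into \<G>). ?Q p)" by (rule arg_cong)
    also have "\<dots> = (\<Union>i. q i)" unfolding q_def image_image ..
    also have "\<dots> = (\<Union>n. A n)" by (auto simp: A_def)
    also have "emeasure \<mu> \<dots> = (SUP n. emeasure \<mu> (A n))"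
    proof (rule SUP_emeasure_incseq[OF A, symmetric])
      show "incseq A" unfolding incseq_def A_def by (intro allI impI UN_mono) auto
    qed
    also have "\<dots> \<le> ennreal (4 * D) * emeasure \<mu> (W - E)"
    proof (rule SUP_least)
      fix n
      have "A n = (\<Union>p\<in>from_nat_into \<G> ` {..<n}. ?Q p)" unfolding A_def q_def image_image ..
      also have "emeasure \<mu> \<dots> \<le> ennreal (4 * D) * emeasure \<mu> (W - E)"
        using from_nat_into[OF False] \<G>(2) by (intro fin) auto
      finally show "emeasure \<mu> (A n) \<le> ennreal (4 * D) * emeasure \<mu> (W - E)" .
    qed
    finally show ?thesis unfolding U .
  qed
qed

section \<open>Cylinders against their forward stacks\<close>

text \<open>
  Fix \<open>x\<close> and follow the trajectories \<open>t \<mapsto> (x, y + t v(x), t)\<close>. A trajectory that meets a cylinder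
  deviates from its axis at a rate \<open>|v(x) - v\<^sub>P| < r\<close>, so within time \<open>(L + 1) r\<^sup>2\<close> the
  initial deviation \<open>r\<^sup>3\<close> grows to at most \<open>(L + 2) r\<^sup>3\<close>. This is the width of the stack, so the
  trajectory stays in the stack for its whole life span, and \<open>interval_stacking\<close>
  applies on each trajectory.
\<close>

lemma stacking_lemma:
  fixes \<iota> :: "'m::finite \<Rightarrow> 'n::finite" and P :: "nat \<Rightarrow> ('n, 'm) point"
  assumes w: "locally_integrable w" and \<iota>: "inj \<iota>" and r: "\<And>i. 0 < r i" and L: "1 \<le> L"
  shows "emeasure (weighted_measure w) (\<Union>i. cylinder \<iota> (r i) (P i))
    \<le> ennreal ((real L + 1) / real L) * emeasure (weighted_measure w) (\<Union>i. forward_stack \<iota> L (r i) (P i))"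
    (is "emeasure _ ?G \<le> ?c * emeasure _ ?S")
proof -
  have L0: "0 < real L" using L by simp
  have "open ?G" "open ?S" by (intro open_UN ballI open_cylinder open_forward_stack)+
  then have GS: "?G \<in> sets borel" "?S \<in> sets borel" by auto
  define tP where "tP i = snd (snd (P i))" for i
  have fibre: "emeasure lborel {t. (x, y + t *\<^sub>R velocity \<iota> x, t) \<in> ?G}
      \<le> ?c * emeasure lborel {t. (x, y + t *\<^sub>R velocity \<iota> x, t) \<in> ?S}" for x y
  proof -
    let ?z = "\<lambda>t. (x, y + t *\<^sub>R velocity \<iota> x, t)"
    define J where "J = {i. \<exists>t. ?z t \<in> cylinder \<iota> (r i) (P i)}"
    have 1: "{t. ?z t \<in> ?G} \<subseteq> (\<Union>i\<in>J. {tP i - (r i)\<^sup>2<..<tP i})"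
    proof
      fix t assume "t \<in> {t. ?z t \<in> ?G}"
      then obtain i where i: "?z t \<in> cylinder \<iota> (r i) (P i)" by auto
      then have "i \<in> J" by (auto simp: J_def)
      moreover have "t \<in> {tP i - (r i)\<^sup>2<..<tP i}"
        using i by (cases "P i") (auto simp: tP_def cylinder.simps)
      ultimately show "t \<in> (\<Union>i\<in>J. {tP i - (r i)\<^sup>2<..<tP i})" by auto
    qed
    have 2: "(\<Union>i\<in>J. {tP i<..<tP i + real L * (r i)\<^sup>2}) \<subseteq> {t. ?z t \<in> ?S}"
    proof
      fix s assume "s \<in> (\<Union>i\<in>J. {tP i<..<tP i + real L * (r i)\<^sup>2})"
      then obtain i t where i: "?z t \<in> cylinder \<iota> (r i) (P i)"
        and s: "tP i < s" "s < tP i + real L * (r i)\<^sup>2"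
        by (auto simp: J_def)
      obtain a b c where P: "P i = (a, b, c)" by (cases "P i")
      have c: "tP i = c" by (simp add: tP_def P)
      let ?v = "velocity \<iota> a" and ?u = "velocity \<iota> x" and ?r = "r i"
      have t: "norm (x - a) < ?r" "norm (y + t *\<^sub>R ?u - b - (t - c) *\<^sub>R ?v) < ?r ^ 3"
        "c - ?r\<^sup>2 < t" "t < c"
        using i by (auto simp: P cylinder.simps)
      have du: "norm (?u - ?v) < ?r" using velocity_lipschitz[OF \<iota>, of x a] t(1) by linarith
      have st: "0 < s - t" "s - t < (real L + 1) * ?r\<^sup>2"
        using s t c by (auto simp: algebra_simps)
      have "norm ((s - t) *\<^sub>R (?u - ?v)) = (s - t) * norm (?u - ?v)"
        using st by simp
      also have "\<dots> \<le> ((real L + 1) * ?r\<^sup>2) * ?r"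
        using st du by (intro mult_mono) auto
      finally have d: "norm ((s - t) *\<^sub>R (?u - ?v)) \<le> (real L + 1) * ?r ^ 3"
        by (simp add: power2_eq_square power3_eq_cube ac_simps)
      have "y + s *\<^sub>R ?u - b - (s - c) *\<^sub>R ?v
          = (y + t *\<^sub>R ?u - b - (t - c) *\<^sub>R ?v) + (s - t) *\<^sub>R (?u - ?v)"
        by (simp add: algebra_simps)
      also have "norm \<dots> \<le> norm (y + t *\<^sub>R ?u - b - (t - c) *\<^sub>R ?v) + norm ((s - t) *\<^sub>R (?u - ?v))"
        by (rule norm_triangle_ineq)
      also have "\<dots> < (real L + 2) * ?r ^ 3"
        using t(2) d by (simp add: algebra_simps)
      finally have "?z s \<in> forward_stack \<iota> L ?r (P i)"
        using s t(1) c by (simp add: P forward_stack.simps)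
      then show "s \<in> {t. ?z t \<in> ?S}" by auto
    qed
    have "continuous_on UNIV ?z" by (intro continuous_intros)
    then have m: "{t. ?z t \<in> ?S} \<in> sets borel"
      using measurable_sets[OF borel_measurable_continuous_onI GS(2)] by (simp add: vimage_def)
    have "emeasure lborel {t. ?z t \<in> ?G} \<le> emeasure lborel (\<Union>i\<in>J. {tP i - (r i)\<^sup>2<..<tP i})"
      using 1 by (intro emeasure_mono) auto
    also have "\<dots> \<le> ?c * emeasure lborel (\<Union>i\<in>J. {tP i<..<tP i + real L * (r i)\<^sup>2})"
      by (intro interval_stacking zero_less_power r L0)
    also have "\<dots> \<le> ?c * emeasure lborel {t. ?z t \<in> ?S}"
      using 2 m by (intro mult_left_mono emeasure_mono) auto
    finally show ?thesis .
  qed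
  have slice: "emeasure lborel {p. (x, p) \<in> ?G} \<le> ?c * emeasure lborel {p. (x, p) \<in> ?S}" for x
  proof -
    note m = slice_borel[OF GS(1), of x] slice_borel[OF GS(2), of x]
    have ms: "(\<lambda>y. emeasure lborel {t. (x, y + t *\<^sub>R velocity \<iota> x, t) \<in> ?S}) \<in> borel_measurable lborel"
    proof -
      have "continuous_on UNIV (\<lambda>q. (x, fst q + snd q *\<^sub>R velocity \<iota> x, snd q))"
        by (intro continuous_intros)
      then have "(\<lambda>q :: _ \<times> real. (x, fst q + snd q *\<^sub>R velocity \<iota> x, snd q)) -` ?S \<in> sets borel"
        using measurable_sets[OF borel_measurable_continuous_onI GS(2)] by simp
      then have "(\<lambda>q :: _ \<times> real. (x, fst q + snd q *\<^sub>R velocity \<iota> x, snd q)) -` ?S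
          \<in> sets (lborel \<Otimes>\<^sub>M lborel)" by (simp only: lborel_prod sets_lborel)
      from lborel.measurable_emeasure_Pair[OF this] show ?thesis by (simp add: vimage_def)
    qed
    have "emeasure lborel {p. (x, p) \<in> ?G}
        = (\<integral>\<^sup>+y. emeasure lborel {t. (x, y + t *\<^sub>R velocity \<iota> x, t) \<in> ?G} \<partial>lborel)"
      using emeasure_sheared_slices[OF m(1), of "velocity \<iota> x"] by simp
    also have "\<dots> \<le> (\<integral>\<^sup>+y. ?c * emeasure lborel {t. (x, y + t *\<^sub>R velocity \<iota> x, t) \<in> ?S} \<partial>lborel)"
      by (intro nn_integral_mono fibre)
    also have "\<dots> = ?c * (\<integral>\<^sup>+y. emeasure lborel {t. (x, y + t *\<^sub>R velocity \<iota> x, t) \<in> ?S} \<partial>lborel)"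
      by (rule nn_integral_cmult[OF ms])
    also have "\<dots> = ?c * emeasure lborel {p. (x, p) \<in> ?S}"
      using emeasure_sheared_slices[OF m(2), of "velocity \<iota> x"] by simp
    finally show ?thesis .
  qed
  have mS: "(\<lambda>x. ennreal (w x) * emeasure lborel {p. (x, p) \<in> ?S}) \<in> borel_measurable lebesgue"
  proof (intro borel_measurable_times_ennreal)
    show "(\<lambda>x. ennreal (w x)) \<in> borel_measurable lebesgue"
      using locally_integrable_measurable[OF w] by simp
    have "?S \<in> sets (lborel \<Otimes>\<^sub>M lborel)" using GS(2) by (simp only: lborel_prod sets_lborel)
    from lborel.measurable_emeasure_Pair[OF this]
    show "(\<lambda>x. emeasure lborel {p. (x, p) \<in> ?S}) \<in> borel_measurable lebesgue"
      by (intro measurable_completion) (simp add: vimage_def)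
  qed
  have "emeasure (weighted_measure w) ?G
      \<le> (\<integral>\<^sup>+x. ?c * (ennreal (w x) * emeasure lborel {p. (x, p) \<in> ?S}) \<partial>lebesgue)"
    unfolding emeasure_weighted_measure_slices[OF w GS(1)]
    using mult_left_mono[OF slice] by (intro nn_integral_mono) (auto simp: ac_simps)
  also have "\<dots> = ?c * emeasure (weighted_measure w) ?S"
    unfolding emeasure_weighted_measure_slices[OF w GS(2)] by (rule nn_integral_cmult[OF mS])
  finally show ?thesis .
qed

section \<open>Continuity and outer regularity\<close>

text \<open>
  Dominated convergence: off the null set \<open>N s\<close>, membership in \<open>Q s'\<close> does not change for \<open>s'\<close> near \<open>s\<close>.
\<close>

lemma continuous_on_measure_family:
  fixes Q :: "real \<Rightarrow> 'a set"
  assumes W: "W \<in> sets M" "emeasure M W < \<infinity>"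
    and Q: "\<And>s. s \<in> S \<Longrightarrow> Q s \<in> sets M" "\<And>s. s \<in> S \<Longrightarrow> Q s \<subseteq> W"
    and N: "\<And>s. s \<in> S \<Longrightarrow> N s \<in> null_sets M"
      "\<And>s z. s \<in> S \<Longrightarrow> z \<notin> N s \<Longrightarrow> \<forall>\<^sub>F s' in nhds s. z \<in> Q s' \<longleftrightarrow> z \<in> Q s"
  shows "continuous_on S (\<lambda>s. measure M (Q s))"
proof -
  have "(\<lambda>n. measure M (Q (\<sigma> n))) \<longlonglongrightarrow> measure M (Q s)"
    if \<sigma>: "\<And>n. \<sigma> n \<in> S" "\<sigma> \<longlonglongrightarrow> s" and s: "s \<in> S" for \<sigma> s
  proof -
    have "(\<lambda>n. \<integral>z. indicator (Q (\<sigma> n)) z \<partial>M) \<longlonglongrightarrow> (\<integral>z. indicator (Q s) z \<partial>M :: real)"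
    proof (rule integral_dominated_convergence[where w = "indicator W"])
      show "AE z in M. (\<lambda>n. indicator (Q (\<sigma> n)) z :: real) \<longlonglongrightarrow> indicator (Q s) z"
        using AE_not_in[OF N(1)[OF s]]
      proof eventually_elim
        case (elim z)
        have "\<forall>\<^sub>F n in sequentially. z \<in> Q (\<sigma> n) \<longleftrightarrow> z \<in> Q s"
          by (rule eventually_compose_filterlim[OF N(2)[OF s elim] \<sigma>(2)])
        then show ?case
          by (intro tendsto_eventually) (auto elim!: eventually_mono simp: indicator_def)
      qed
      show "AE z in M. norm (indicator (Q (\<sigma> n)) z :: real) \<le> indicator W z" for n
        using Q(2)[OF \<sigma>(1)] by (auto simp: indicator_def)
    qed (use Q W s \<sigma> in auto)
    then show ?thesis using Q(1) s \<sigma>(1) by (simp add: sets.Int_space_eq2)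
  qed
  then show ?thesis
    unfolding continuous_on_sequentially comp_def by blast
qed

lemma eventually_neg_iff:
  fixes h :: "real \<Rightarrow> real"
  assumes "isCont h s" and "h s \<noteq> 0"
  shows "\<forall>\<^sub>F s' in nhds s. h s' < 0 \<longleftrightarrow> h s < 0"
proof -
  have lim: "(h \<longlongrightarrow> h s) (nhds s)"
    using assms(1) by (simp add: continuous_at_imp_continuous_at_within isCont_def tendsto_nhds_iff)
  show ?thesis
  proof (cases "h s < 0")
    case True
    then show ?thesis using order_tendstoD(2)[OF lim True] by (auto elim: eventually_mono)
  next
    case False
    then have "0 < h s" using assms(2) by linarith
    then show ?thesis using order_tendstoD(1)[OF lim, of 0] False by (auto elim!: eventually_mono)
  qed
qed

lemma weighted_measure_null_of_lebesgue_null: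
  assumes w: "locally_integrable w" and N: "N \<in> null_sets lebesgue"
  shows "N \<in> null_sets (weighted_measure w)"
proof -
  have "AE z in lebesgue. z \<in> N \<longrightarrow> (case z of (x, y, t) \<Rightarrow> ennreal (w x)) = 0"
    using AE_not_in[OF N] by eventually_elim simp
  then show ?thesis
    unfolding weighted_measure_def null_sets_density_iff[OF weight_measurable[OF w]] using N by auto
qed

text \<open>
  Decreasing open sets whose Lebesgue excess over \<open>S\<close> tends to zero have a Lebesgue null, hence
  \<open>\<mu>\<close>-null, limiting excess. Continuity from above, inside \<open>Q\<close> of finite measure, then makes the
  \<open>\<mu>\<close>-excess small.
\<close>

lemma weighted_measure_outer_open:
  fixes S Q :: "('n::finite, 'm::finite) point set"
  assumes w: "locally_integrable w" and S: "S \<in> sets lebesgue" "S \<subseteq> Q"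
    and Q: "open Q" "emeasure (weighted_measure w) Q < \<infinity>" and e: "0 < (e :: ennreal)"
  shows "\<exists>U. open U \<and> S \<subseteq> U \<and> U \<subseteq> Q \<and> emeasure (weighted_measure w) (U - S) < e"
proof -
  let ?\<mu> = "weighted_measure w :: ('n, 'm) point measure"
  have "\<exists>T. open T \<and> S \<subseteq> T \<and> emeasure lebesgue (T - S) < ennreal (1 / Suc n)" for n
    using sets_lebesgue_outer_open[OF S(1), of "1 / Suc n"] by (metis divide_pos_pos of_nat_0_less_iff zero_less_Suc zero_less_one)
  then obtain T where T: "\<And>n. open (T n)" "\<And>n. S \<subseteq> T n"
    "\<And>n. emeasure lebesgue (T n - S) < ennreal (1 / Suc n)" by metis
  define U where "U n = Q \<inter> (\<Inter>k\<le>n. T k)" for n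
  have oU: "open (U n)" for n unfolding U_def using Q(1) T(1) by (intro open_Int open_INT) auto
  have SU: "S \<subseteq> U n" for n using T(2) S(2) by (auto simp: U_def)
  have sets: "U n - S \<in> sets lebesgue" for n using oU[of n] S(1) by auto
  have "(\<lambda>n. emeasure ?\<mu> (U n - S)) \<longlonglongrightarrow> emeasure ?\<mu> (\<Inter>n. U n - S)"
  proof (rule Lim_emeasure_decseq)
    show "range (\<lambda>n. U n - S) \<subseteq> sets ?\<mu>" using sets by auto
    show "decseq (\<lambda>n. U n - S)" by (auto simp: decseq_def U_def)
    have "emeasure ?\<mu> (U n - S) \<le> emeasure ?\<mu> Q" for n
      using Q(1) by (intro emeasure_mono) (auto simp: U_def)
    then show "emeasure ?\<mu> (U n - S) \<noteq> \<infinity>" for n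
      using Q(2) by (metis infinity_ennreal_def leD)
  qed
  moreover have "(\<Inter>n. U n - S) \<in> null_sets lebesgue"
  proof -
    have m: "(\<Inter>n. U n - S) \<in> sets lebesgue"
      using sets by (intro sets.countable_INT) auto
    have "emeasure lebesgue (\<Inter>n. U n - S) \<le> ennreal (1 / Suc n)" for n
    proof -
      have "emeasure lebesgue (\<Inter>n. U n - S) \<le> emeasure lebesgue (T n - S)"
        using T(1)[of n] S(1) by (intro emeasure_mono) (auto simp: U_def)
      then show ?thesis using T(3)[of n] by (meson less_imp_le order_trans)
    qed
    moreover have "(\<lambda>n. ennreal (1 / Suc n)) \<longlonglongrightarrow> ennreal 0"
      by (intro tendsto_ennrealI LIMSEQ_Suc[OF lim_1_over_n])
    ultimately have "emeasure lebesgue (\<Inter>n. U n - S) \<le> ennreal 0"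
      by (intro LIMSEQ_le_const) auto
    then show ?thesis using m by (simp add: null_sets_def)
  qed
  then have "emeasure ?\<mu> (\<Inter>n. U n - S) = 0"
    using weighted_measure_null_of_lebesgue_null[OF w] by blast
  ultimately have "\<forall>\<^sub>F n in sequentially. emeasure ?\<mu> (U n - S) < e"
    using e by (intro order_tendstoD(2)[where y = "emeasure ?\<mu> (\<Inter>n. U n - S)"]) auto
  then obtain n where "emeasure ?\<mu> (U n - S) < e" by (auto simp: eventually_sequentially)
  then show ?thesis using oU SU by (intro exI[of _ "U n"]) (auto simp: U_def)
qed

section \<open>Contracting the reference cylinder towards a point\<close>

locale reference_cylinder =
  fixes \<iota> :: "'m::finite \<Rightarrow> 'n::finite" and w :: "real ^ 'n \<Rightarrow> real" and M R :: real
    and x0 :: "real ^ 'n" and y0 :: "real ^ 'm" and t0 :: real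
  assumes inj: "inj \<iota>" and weight: "A2_weight_le M w" and R: "0 < R"
begin

abbreviation \<mu> :: "('n, 'm) point measure" where "\<mu> \<equiv> weighted_measure w"
abbreviation Q :: "('n, 'm) point set" where "Q \<equiv> cylinder \<iota> R (x0, y0, t0)"

lemmas weight_integrable = A2_weight_leD(2)[OF weight]

lemma in_Q: "(x, y, t) \<in> Q \<longleftrightarrow> norm (x - x0) < R
    \<and> norm (y - y0 - (t - t0) *\<^sub>R velocity \<iota> x0) < R ^ 3 \<and> t0 - R\<^sup>2 < t \<and> t < t0"
  by (simp add: cylinder.simps)

lemma cylinder_sets: "cylinder \<iota> r P \<in> sets \<mu>"
  by (rule open_in_weighted_sets[OF open_cylinder])

lemma cylinder_emeasure:
  assumes "0 < r"
  shows "0 < measure \<mu> (cylinder \<iota> r P)" "emeasure \<mu> (cylinder \<iota> r P) < \<infinity>"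
proof -
  obtain a b c where P: "P = (a, b, c)" by (cases P)
  have "0 < unit_ball_vol (real CARD('m))" by simp
  then show "0 < measure \<mu> (cylinder \<iota> r P)"
    using assms ball_mass_pos[OF weight_integrable A2_weight_leD(1)[OF weight] assms, of a]
    unfolding P cylinder_tube by (subst measure_tube(2)[OF weight_integrable]) auto
  show "emeasure \<mu> (cylinder \<iota> r P) < \<infinity>"
    using assms unfolding P cylinder_tube by (subst measure_tube(1)[OF weight_integrable]) auto
qed

text \<open>
  Up to the Galilean drift, the centre of the image of the reference cylinder under the contraction by the
  factor \<open>s\<close> towards \<open>X\<close>, parabolic in time. The \<open>y\<close>-coordinate is not contracted but chosen so that \<open>X\<close> lies on
  the axis of the cylinder: the velocities at the centres of the two cylinders differ by up to \<open>R\<close>, which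
  shifts points by up to \<open>s\<^sup>2 R\<^sup>3\<close> over the life span, and a contraction in \<open>y\<close> by \<open>s\<^sup>3\<close> could not
  make up for that.
\<close>

definition pulled_center :: "('n, 'm) point \<Rightarrow> real \<Rightarrow> ('n, 'm) point" where
  "pulled_center X s = (case X of (x, y, t) \<Rightarrow>
     let a = x + s *\<^sub>R (x0 - x); c = t + s\<^sup>2 * (t0 - t)
     in (a, y + (c - t) *\<^sub>R velocity \<iota> a, c))"

abbreviation pulled :: "('n, 'm) point \<Rightarrow> real \<Rightarrow> ('n, 'm) point set" where
  "pulled X s \<equiv> cylinder \<iota> (s * R) (pulled_center X s)"

lemma in_pulled:
  fixes x y t s
  defines "a \<equiv> x + s *\<^sub>R (x0 - x)" and "c \<equiv> t + s\<^sup>2 * (t0 - t)"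
  shows "(x', y', t') \<in> pulled (x, y, t) s \<longleftrightarrow> norm (x' - a) < s * R
    \<and> norm (y' - y - (t' - t) *\<^sub>R velocity \<iota> a) < (s * R) ^ 3 \<and> c - (s * R)\<^sup>2 < t' \<and> t' < c"
  unfolding pulled_center_def a_def c_def Let_def prod.case cylinder.simps mem_Collect_eq
  by (simp add: algebra_simps)

lemma pulled_contains:
  assumes X: "X \<in> Q" and s: "0 < s"
  shows "X \<in> pulled X s"
proof -
  obtain x y t where z: "X = (x, y, t)" by (cases X)
  have q: "norm (x - x0) < R" "t0 - R\<^sup>2 < t" "t < t0" using X unfolding z in_Q by auto
  have "x - (x + s *\<^sub>R (x0 - x)) = s *\<^sub>R (x - x0)" by (simp add: algebra_simps)
  then have "norm (x - (x + s *\<^sub>R (x0 - x))) < s * R" using q(1) s by simp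
  moreover have "0 < s\<^sup>2 * (t0 - t)" "s\<^sup>2 * (t0 - t) < s\<^sup>2 * R\<^sup>2" using s q by auto
  ultimately show ?thesis
    unfolding z in_pulled using s R by (simp add: power_mult_distrib)
qed

text \<open>
  In \<open>x\<close> and \<open>t\<close> a contraction towards a point of a convex set maps the set into itself, up to the very
  boundary. In \<open>y\<close> a reserve of \<open>2 s\<^sup>2 R\<^sup>3\<close> is needed: one \<open>s\<^sup>2 R\<^sup>3\<close> for the drift mismatch, and one for
  the width \<open>s\<^sup>3 R\<^sup>3\<close>.
\<close>

lemma pulled_subset:
  assumes X: "(x, y, t) \<in> Q" and s: "0 < s" "s \<le> 1"
    and depth: "norm (y - y0 - (t - t0) *\<^sub>R velocity \<iota> x0) + 2 * s\<^sup>2 * R ^ 3 \<le> R ^ 3"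
  shows "pulled (x, y, t) s \<subseteq> Q"
proof
  fix z assume z: "z \<in> pulled (x, y, t) s"
  obtain x' y' t' where zz: "z = (x', y', t')" by (cases z)
  define a where "a = x + s *\<^sub>R (x0 - x)"
  let ?u = "velocity \<iota> a" and ?v = "velocity \<iota> x0"
  note p0 = z[unfolded zz in_pulled, folded a_def]
  note p1 = p0[THEN conjunct2] note p2 = p1[THEN conjunct2]
  note p = p0[THEN conjunct1] p1[THEN conjunct1] p2[THEN conjunct1] p2[THEN conjunct2]
  have q: "norm (x - x0) < R" "t0 - R\<^sup>2 < t" "t < t0" using X unfolding in_Q by auto
  have "a - x0 = (1 - s) *\<^sub>R (x - x0)" by (simp add: a_def algebra_simps)
  then have "norm (a - x0) = (1 - s) * norm (x - x0)" using s by simp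
  also have "\<dots> \<le> (1 - s) * R" using q s by (intro mult_left_mono) auto
  finally have a: "norm (a - x0) \<le> (1 - s) * R" .
  have X': "norm (x' - x0) < R"
    using norm_triangle_ineq[of "x' - a" "a - x0"] a p by (simp add: algebra_simps)
  have s2: "s\<^sup>2 \<le> 1" using s by (simp add: power_le_one)
  have T': "t' < t0"
  proof -
    have "s\<^sup>2 * (t0 - t) \<le> t0 - t" using mult_right_mono[OF s2, of "t0 - t"] q by simp
    then show ?thesis using p(4) by linarith
  qed
  have T: "t0 - R\<^sup>2 < t'"
  proof -
    have "s\<^sup>2 * (R\<^sup>2 - (t0 - t)) \<le> 1 * (R\<^sup>2 - (t0 - t))" using s2 q by (intro mult_right_mono) auto
    then show ?thesis using p by (simp add: power_mult_distrib algebra_simps)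
  qed
  have "\<bar>t' - t\<bar> \<le> s\<^sup>2 * R\<^sup>2"
  proof -
    have "0 \<le> s\<^sup>2 * (t0 - t)" "s\<^sup>2 * (t0 - t) \<le> s\<^sup>2 * R\<^sup>2"
        using q by (auto intro!: mult_left_mono)
    then show ?thesis using p by (simp add: power_mult_distrib)
  qed
  moreover have "norm (?u - ?v) \<le> R"
  proof -
    have "(1 - s) * R \<le> R" using s R by simp
    then show ?thesis using velocity_lipschitz[OF inj, of a x0] a by linarith
  qed
  ultimately have "\<bar>t' - t\<bar> * norm (?u - ?v) \<le> (s\<^sup>2 * R\<^sup>2) * R" by (intro mult_mono) auto
  then have drift: "norm ((t' - t) *\<^sub>R (?u - ?v)) \<le> s\<^sup>2 * R ^ 3"
    by (simp add: power2_eq_square power3_eq_cube ac_simps)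
  have cube: "(s * R) ^ 3 \<le> s\<^sup>2 * R ^ 3"
    using s R by (simp add: power_mult_distrib mult_right_mono power_decreasing)
  have "y' - y0 - (t' - t0) *\<^sub>R ?v = (y' - y - (t' - t) *\<^sub>R ?u)
      + (y - y0 - (t - t0) *\<^sub>R ?v) + (t' - t) *\<^sub>R (?u - ?v)"
    by (simp add: algebra_simps)
  also have "norm \<dots> \<le> norm (y' - y - (t' - t) *\<^sub>R ?u) + norm (y - y0 - (t - t0) *\<^sub>R ?v)
      + norm ((t' - t) *\<^sub>R (?u - ?v))"
    by (intro order_trans[OF norm_triangle_ineq] add_right_mono norm_triangle_ineq)
  also have "\<dots> < R ^ 3" using p drift cube depth by linarith
  finally show "z \<in> Q" using X' T T' unfolding zz in_Q by blast
qed

lemma pulled_small: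
  assumes X: "X \<in> Q" and U: "open U" "X \<in> U" and \<delta>: "0 < \<delta>" "\<delta> \<le> 1"
  shows "\<exists>s. 0 < s \<and> s \<le> \<delta> \<and> pulled X s \<subseteq> U"
proof -
  obtain x y t where z: "X = (x, y, t)" by (cases X)
  have q: "norm (x - x0) < R" "t0 - R\<^sup>2 < t" "t < t0" using X unfolding z in_Q by auto
  obtain e where e: "0 < e" "ball X e \<subseteq> U" using U openE by blast
  define K where "K = norm x + R"
  define C where "C = 2 * R + R ^ 3 + R\<^sup>2 * K + R\<^sup>2"
  have K: "0 \<le> K" using R by (simp add: K_def)
  have C: "0 < C"
    using R K by (auto simp: C_def intro!: add_pos_nonneg)
  \<comment> \<open>The cylinder with parameter \<open>s \<le> 1\<close> lies in the ball of radius \<open>s C\<close> around \<open>X\<close>.\<close>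
  define s where "s = min \<delta> (e / C)"
  have s: "0 < s" "s \<le> \<delta>" "s * C \<le> e"
    using \<delta> e C by (auto simp: s_def min_def field_simps)
  then have "s \<le> 1" using \<delta> by linarith
  have "pulled X s \<subseteq> ball X e"
  proof
    fix z' assume z': "z' \<in> pulled X s"
    obtain x' y' t' where zz: "z' = (x', y', t')" by (cases z')
    define a where "a = x + s *\<^sub>R (x0 - x)"
    let ?u = "velocity \<iota> a"
    note p0 = z'[unfolded zz z in_pulled, folded a_def]
  note p1 = p0[THEN conjunct2] note p2 = p1[THEN conjunct2]
  note p = p0[THEN conjunct1] p1[THEN conjunct1] p2[THEN conjunct1] p2[THEN conjunct2]
    have sx: "norm (s *\<^sub>R (x0 - x)) < s * R" using q s by (simp add: norm_minus_commute)
    have "s * R \<le> R" using \<open>s \<le> 1\<close> R by simp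
    then have "norm a \<le> K"
      unfolding a_def K_def using norm_triangle_ineq[of x "s *\<^sub>R (x0 - x)"] sx by linarith
    then have u: "norm ?u \<le> K" using norm_velocity_le[OF inj, of a] by linarith
    have "s\<^sup>2 \<le> s * 1" "s ^ 3 \<le> s * 1"
      using s \<open>s \<le> 1\<close> by (auto simp: power2_eq_square power3_eq_cube mult_le_one intro!: mult_left_mono)
    then have ss: "s\<^sup>2 * R\<^sup>2 \<le> s * R\<^sup>2" "(s * R) ^ 3 \<le> s * R ^ 3"
      using R by (auto simp: power_mult_distrib)
    have dt: "\<bar>t' - t\<bar> \<le> s * R\<^sup>2"
    proof -
      have "0 \<le> s\<^sup>2 * (t0 - t)" "s\<^sup>2 * (t0 - t) \<le> s\<^sup>2 * R\<^sup>2"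
        using q by (auto intro!: mult_left_mono)
      then have "\<bar>t' - t\<bar> \<le> s\<^sup>2 * R\<^sup>2" using p by (simp add: power_mult_distrib)
      then show ?thesis using ss by simp
    qed
    have "norm (x' - x) \<le> norm (x' - a) + norm (a - x)"
      using norm_triangle_ineq[of "x' - a" "a - x"] by simp
    then have dx: "norm (x' - x) < 2 * (s * R)" using p sx by (simp add: a_def)
    have "norm (y' - y) \<le> norm (y' - y - (t' - t) *\<^sub>R ?u) + norm ((t' - t) *\<^sub>R ?u)"
      using norm_triangle_ineq[of "y' - y - (t' - t) *\<^sub>R ?u" "(t' - t) *\<^sub>R ?u"] by simp
    moreover have "norm ((t' - t) *\<^sub>R ?u) \<le> (s * R\<^sup>2) * K"
      using dt u K by (auto intro!: mult_mono)
    ultimately have dy: "norm (y' - y) \<le> s * R ^ 3 + (s * R\<^sup>2) * K" using p ss by linarith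
    have "z' - X = (x' - x, y' - y, t' - t)" unfolding z zz by simp
    then have "dist X z' = norm (x' - x, y' - y, t' - t)"
      unfolding dist_commute[of X z'] dist_norm[of z' X] by (rule arg_cong)
    also have "\<dots> \<le> norm (x' - x) + (norm (y' - y) + norm (t' - t))"
      by (intro order_trans[OF norm_Pair_le] add_left_mono norm_Pair_le)
    also have "\<dots> < s * C" using dx dy dt by (simp add: C_def algebra_simps)
    also have "\<dots> \<le> e" by (rule s(3))
    finally show "z' \<in> ball X e" unfolding mem_ball .
  qed
  then show ?thesis using s e(2) by blast
qed

lemma continuous_on_pulled_measure:
  assumes A: "A \<in> sets \<mu>" and S: "\<And>s. s \<in> S \<Longrightarrow> pulled X s \<subseteq> Q"
  shows "continuous_on S (\<lambda>s. measure \<mu> (A \<inter> pulled X s))"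
proof -
  obtain x y t where z: "X = (x, y, t)" by (cases X)
  define a where "a s = x + s *\<^sub>R (x0 - x)" for s
  define c where "c s = t + s\<^sup>2 * (t0 - t)" for s
  define N where "N s = {(x', y', t'). norm (x' - a s) = s * R
      \<or> norm (y' - (y - t *\<^sub>R velocity \<iota> (a s)) - t' *\<^sub>R velocity \<iota> (a s)) = (s * R) ^ 3
      \<or> t' = c s - (s * R)\<^sup>2 \<or> t' = c s}" for s
  have va: "velocity \<iota> (a s) = velocity \<iota> x + s *\<^sub>R velocity \<iota> (x0 - x)" for s
    unfolding a_def by (rule velocity_add_scale)
  show ?thesis
  proof (rule continuous_on_measure_family[where W = Q and N = N])
    show "Q \<in> sets \<mu>" by (rule cylinder_sets)
    show "emeasure \<mu> Q < \<infinity>" by (rule cylinder_emeasure(2)[OF R])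
    show "A \<inter> pulled X s \<in> sets \<mu>" for s using A cylinder_sets by blast
    show "A \<inter> pulled X s \<subseteq> Q" if "s \<in> S" for s using S[OF that] by blast
    show "N s \<in> null_sets \<mu>" for s unfolding N_def by (rule tube_boundary_null[OF weight_integrable])
  next
    fix s p assume "p \<notin> N s"
    obtain x' y' t' where p: "p = (x', y', t')" by (cases p)
    let ?h1 = "\<lambda>s. norm (x' - a s) - s * R"
    let ?h2 = "\<lambda>s. norm (y' - y - (t' - t) *\<^sub>R velocity \<iota> (a s)) - (s * R) ^ 3"
    let ?h3 = "\<lambda>s. c s - (s * R)\<^sup>2 - t'" and ?h4 = "\<lambda>s. t' - c s"
    have mem: "p \<in> A \<inter> pulled X s' \<longleftrightarrow> p \<in> A \<and> ?h1 s' < 0 \<and> ?h2 s' < 0 \<and> ?h3 s' < 0 \<and> ?h4 s' < 0" for s'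
      unfolding p z Int_iff in_pulled a_def c_def by auto
    have ne: "?h1 s \<noteq> 0" "?h2 s \<noteq> 0" "?h3 s \<noteq> 0" "?h4 s \<noteq> 0"
      using \<open>p \<notin> N s\<close> unfolding p N_def by (auto simp: algebra_simps)
    have "isCont ?h1 s" "isCont ?h2 s" "isCont ?h3 s" "isCont ?h4 s"
      unfolding va unfolding a_def c_def by (intro continuous_intros)+
    note ev = this[THEN eventually_neg_iff]
    show "\<forall>\<^sub>F s' in nhds s. p \<in> A \<inter> pulled X s' \<longleftrightarrow> p \<in> A \<inter> pulled X s"
      unfolding mem
      using ev(1)[OF ne(1)] ev(2)[OF ne(2)] ev(3)[OF ne(3)] ev(4)[OF ne(4)]
      by eventually_elim blast
  qed
qed

section \<open>Stopping cylinders and the density of the exceptional set\<close>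

definition doubling_const :: real where "doubling_const = max M 1 * (3 ^ CARD('n))\<^sup>2 * 27 ^ CARD('m) * 18"

lemma doubling_const_ge_1: "1 \<le> doubling_const"
proof -
  have "1 * 1 * 1 * 1 \<le> doubling_const" unfolding doubling_const_def by (intro mult_mono) (auto simp: one_le_power)
  then show ?thesis by simp
qed

lemma Q_finite: "A \<subseteq> Q \<Longrightarrow> emeasure \<mu> A < \<infinity>"
  using emeasure_mono[OF _ cylinder_sets, of A R "(x0, y0, t0)"] cylinder_emeasure(2)[OF R]
  by (metis le_less_trans)

lemma Q_fmeasurable: "A \<subseteq> Q \<Longrightarrow> A \<in> sets lebesgue \<Longrightarrow> A \<in> fmeasurable \<mu>"
  using Q_finite by (auto intro!: fmeasurableI)

lemma measure_split:
  assumes C: "C \<in> fmeasurable \<mu>" and E: "E \<in> sets lebesgue"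
  shows "measure \<mu> C = measure \<mu> (E \<inter> C) + measure \<mu> (C - E)"
proof -
  have "measure \<mu> ((E \<inter> C) \<union> (C - E)) = measure \<mu> (E \<inter> C) + measure \<mu> (C - E)"
  proof (rule measure_Union)
    have "C \<in> sets lebesgue" using fmeasurableD[OF C] by simp
    then have "E \<inter> C \<in> fmeasurable \<mu>" "C - E \<in> fmeasurable \<mu>"
      using C E by (auto intro: fmeasurable_Diff fmeasurableI2[OF C])
    then show "emeasure \<mu> (E \<inter> C) \<noteq> \<infinity>" "emeasure \<mu> (C - E) \<noteq> \<infinity>"
      "E \<inter> C \<in> sets \<mu>" "C - E \<in> sets \<mu>"
      by (auto simp: fmeasurable_def)
  qed auto
  then show ?thesis by (metis Int_commute Int_Diff_Un)
qed

lemma sparse_cylinder: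
  assumes r: "0 < r" and E: "E \<in> sets lebesgue"
    and le: "measure \<mu> (E \<inter> cylinder \<iota> r P) \<le> 3 / 4 * measure \<mu> (cylinder \<iota> r P)"
  shows "emeasure \<mu> (cylinder \<iota> r P) \<le> 4 * emeasure \<mu> (cylinder \<iota> r P - E)"
proof -
  let ?C = "cylinder \<iota> r P"
  have C: "?C \<in> fmeasurable \<mu>"
    by (rule fmeasurableI[OF cylinder_sets]) (use cylinder_emeasure(2)[OF r, of P] in \<open>simp only: infinity_ennreal_def\<close>)
  then have CE: "?C - E \<in> fmeasurable \<mu>" using E by (intro fmeasurable_Diff) auto
  have "measure \<mu> ?C \<le> 4 * measure \<mu> (?C - E)"
    using measure_split[OF C E] le by linarith
  then have "ennreal (measure \<mu> ?C) \<le> ennreal (4 * measure \<mu> (?C - E))" by (rule ennreal_leI)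
  then show ?thesis
    by (simp only: emeasure_eq_measure2[OF C] emeasure_eq_measure2[OF CE] ennreal_mult' ennreal_numeral)
qed

lemma covering_bound:
  assumes E: "E \<in> sets lebesgue" and W: "W \<in> sets lebesgue"
    and \<F>: "\<And>P r. (P, r) \<in> \<F> \<Longrightarrow> 0 < r \<and> cylinder \<iota> r P \<subseteq> W
      \<and> measure \<mu> (E \<inter> cylinder \<iota> r P) \<le> 3 / 4 * measure \<mu> (cylinder \<iota> r P)"
  shows "emeasure \<mu> (\<Union>(P, r)\<in>\<F>. cylinder \<iota> r P) \<le> ennreal (4 * doubling_const) * emeasure \<mu> (W - E)"
proof (rule covering_lemma[OF inj])
  show "emeasure \<mu> (enlarged_cylinder \<iota> r P) \<le> ennreal doubling_const * emeasure \<mu> (cylinder \<iota> r P)"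
    if "0 < r" for P r
    unfolding doubling_const_def by (intro enlarged_cylinder_measure_le[OF weight _ _ that]) auto
  show "E \<in> sets \<mu>" "W \<in> sets \<mu>" using E W by auto
  show "0 < r" "cylinder \<iota> r P \<subseteq> W" if "(P, r) \<in> \<F>" for P r using \<F>[OF that] by blast+
  show "emeasure \<mu> (cylinder \<iota> r P) \<le> 4 * emeasure \<mu> (cylinder \<iota> r P - E)"
    if "(P, r) \<in> \<F>" for P r
    using \<F>[OF that] by (intro sparse_cylinder[OF _ E]) blast+
qed

definition deep :: "real \<Rightarrow> ('n, 'm) point set" where
  "deep r0 = {(x, y, t) \<in> Q. norm (y - y0 - (t - t0) *\<^sub>R velocity \<iota> x0) + 2 * r0\<^sup>2 * R ^ 3 \<le> R ^ 3}"

text \<open>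
  The lower bound on the filled fraction brings the forward stack into \<open>F\<close>; the upper one leaves room for the
  covering lemma.
\<close>

definition half_full :: "('n, 'm) point set \<Rightarrow> (('n, 'm) point \<times> real) set" where
  "half_full E = {(P, r). 0 < r \<and> cylinder \<iota> r P \<subseteq> Q
     \<and> measure \<mu> (E \<inter> cylinder \<iota> r P) > 1 / 2 * measure \<mu> (cylinder \<iota> r P)
     \<and> measure \<mu> (E \<inter> cylinder \<iota> r P) \<le> 3 / 4 * measure \<mu> (cylinder \<iota> r P)}"

abbreviation "spots E \<equiv> (\<Union>(P, r)\<in>half_full E. cylinder \<iota> r P)"

lemma open_spots: "open (spots E)"
  unfolding case_prod_beta by (intro open_UN ballI open_cylinder)

lemma spots_sets: "spots E \<in> sets lebesgue"
  using open_in_weighted_sets[OF open_spots] by (simp only: sets_weighted_measure)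

lemma spots_subset: "spots E \<subseteq> Q"
  unfolding half_full_def by blast

lemma Q_sets: "Q \<in> sets lebesgue"
  using cylinder_sets by (simp only: sets_weighted_measure)

lemma deep_sets: "deep r0 \<in> sets lebesgue"
proof -
  let ?B = "{z :: ('n, 'm) point.
      norm (fst (snd z) - y0 - (snd (snd z) - t0) *\<^sub>R velocity \<iota> x0) + 2 * r0\<^sup>2 * R ^ 3 \<le> R ^ 3}"
  have eq: "deep r0 = Q \<inter> ?B"
  proof (rule set_eqI)
    fix z :: "('n, 'm) point"
    show "z \<in> deep r0 \<longleftrightarrow> z \<in> Q \<inter> ?B" by (cases z) (simp add: deep_def)
  qed
  have "continuous_on UNIV (\<lambda>z :: ('n, 'm) point.
      norm (fst (snd z) - y0 - (snd (snd z) - t0) *\<^sub>R velocity \<iota> x0))"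
    by (intro continuous_intros)
  then have "closed ?B"
    by (intro closed_Collect_le continuous_on_add continuous_on_const)
  then have "?B \<in> sets lebesgue" by (intro sets_completionI_sets) (simp only: sets_lborel borel_closed)
  then show ?thesis unfolding eq by (rule sets.Int[OF Q_sets])
qed

lemma deep_subset: "deep r0 \<subseteq> Q"
  unfolding deep_def by blast

text \<open>
  If \<open>E\<close> filled more than half of some cylinder in the family of \<open>X\<close>, it would fill more than three quarters
  of it, as \<open>X\<close> is in no half-full cylinder. At \<open>s = r\<^sub>0\<close> the fraction is at most one half, so by continuity
  it equals three quarters in between, and that cylinder is half-full and contains \<open>X\<close>.
\<close>

lemma stopping:
  assumes E: "E \<in> sets lebesgue" and r0: "0 < r0" "r0 < 1"
    and small: "\<And>P r. 0 < r \<Longrightarrow> cylinder \<iota> r P \<subseteq> Q \<Longrightarrow>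
      measure \<mu> (E \<inter> cylinder \<iota> r P) > 1 / 2 * measure \<mu> (cylinder \<iota> r P) \<Longrightarrow> r < r0 * R"
    and X: "X \<in> deep r0" "X \<notin> spots E" and s: "0 < s" "s \<le> r0"
  shows "measure \<mu> (E \<inter> pulled X s) \<le> 1 / 2 * measure \<mu> (pulled X s)"
proof (rule ccontr)
  assume "\<not> ?thesis"
  then have gt: "1 / 2 * measure \<mu> (pulled X s) < measure \<mu> (E \<inter> pulled X s)" by linarith
  have XQ: "X \<in> Q" using X(1) deep_subset by blast
  have sub: "pulled X s' \<subseteq> Q" if s': "0 < s'" "s' \<le> r0" for s'
  proof -
    obtain x y t where z: "X = (x, y, t)" by (cases X)
    have "norm (y - y0 - (t - t0) *\<^sub>R velocity \<iota> x0) + 2 * r0\<^sup>2 * R ^ 3 \<le> R ^ 3"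
      using X(1) unfolding z deep_def by blast
    moreover have "2 * s'\<^sup>2 * R ^ 3 \<le> 2 * r0\<^sup>2 * R ^ 3"
      using s' R by (intro mult_right_mono mult_left_mono power_mono) auto
    ultimately show ?thesis
      using XQ s' r0 unfolding z by (intro pulled_subset) linarith+
  qed
  let ?h = "\<lambda>s. measure \<mu> (E \<inter> pulled X s) - 3 / 4 * measure \<mu> (pulled X s)"
  have none: "\<not> (1 / 2 * measure \<mu> (pulled X s') < measure \<mu> (E \<inter> pulled X s') \<and> ?h s' \<le> 0)"
    if s': "0 < s'" "s' \<le> r0" for s'
  proof
    assume "1 / 2 * measure \<mu> (pulled X s') < measure \<mu> (E \<inter> pulled X s') \<and> ?h s' \<le> 0"
    then have "(pulled_center X s', s' * R) \<in> half_full E"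
      using sub[OF s'] s' R unfolding half_full_def by simp
    then show False using X(2) pulled_contains[OF XQ s'(1)] by blast
  qed
  have top: "?h r0 \<le> 0"
  proof -
    have "\<not> 1 / 2 * measure \<mu> (pulled X r0) < measure \<mu> (E \<inter> pulled X r0)"
    proof
      assume "1 / 2 * measure \<mu> (pulled X r0) < measure \<mu> (E \<inter> pulled X r0)"
      from small[OF mult_pos_pos[OF r0(1) R] sub[OF r0(1) order_refl] this] show False by simp
    qed
    moreover have "0 \<le> measure \<mu> (pulled X r0)" by simp
    ultimately show ?thesis by linarith
  qed
  have "0 < ?h s" using none[OF s] gt by linarith
  have cont: "continuous_on {s..r0} ?h"
  proof (intro continuous_intros)
    show "continuous_on {s..r0} (\<lambda>s. measure \<mu> (E \<inter> pulled X s))"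
      using E s sub by (intro continuous_on_pulled_measure) auto
    have "continuous_on {s..r0} (\<lambda>s. measure \<mu> (UNIV \<inter> pulled X s))"
      using s sub by (intro continuous_on_pulled_measure) auto
    then show "continuous_on {s..r0} (\<lambda>s. measure \<mu> (pulled X s))" by (simp only: Int_UNIV_left)
  qed
  obtain s' where s': "s \<le> s'" "s' \<le> r0" "?h s' = 0"
    using IVT2'[of ?h r0 0 s] top \<open>0 < ?h s\<close> s(2) cont by auto
  have "0 < measure \<mu> (pulled X s')" using s s' R by (intro cylinder_emeasure(1)) auto
  then show False using none[of s'] s s' by linarith
qed

text \<open>
  A substitute for the Lebesgue density theorem. Take an open \<open>U \<supseteq> E \<inter> Q\<close> with small excess over \<open>E\<close>. By
  \<open>stopping\<close> each exceptional point lies in arbitrarily small cylinders that are at most half filled,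
  in particular in one inside \<open>U\<close>. The covering lemma then bounds the measure of the exceptional set by a
  fixed multiple of \<open>\<mu>(U - E)\<close>.
\<close>

lemma deep_outside_spots_null:
  assumes E: "E \<in> sets lebesgue" and r0: "0 < r0" "r0 < 1"
    and small: "\<And>P r. 0 < r \<Longrightarrow> cylinder \<iota> r P \<subseteq> Q \<Longrightarrow>
      measure \<mu> (E \<inter> cylinder \<iota> r P) > 1 / 2 * measure \<mu> (cylinder \<iota> r P) \<Longrightarrow> r < r0 * R"
  shows "measure \<mu> (E \<inter> deep r0 - spots E) = 0"
proof (rule ccontr)
  let ?N = "E \<inter> deep r0 - spots E"
  have NQ: "?N \<subseteq> Q" using deep_subset by blast
  have N: "?N \<in> sets lebesgue" by (intro sets.Diff sets.Int E deep_sets spots_sets)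
  have EQ: "E \<inter> Q \<in> sets lebesgue" by (intro sets.Int E Q_sets)
  assume "measure \<mu> ?N \<noteq> 0"
  then have pos: "0 < measure \<mu> ?N" by (simp add: zero_less_measure_iff)
  \<comment> \<open>With this excess the covering lemma yields \<open>\<mu>(N) \<le> 4 D e < \<mu>(N)\<close>, where \<open>D\<close> is the doubling constant.\<close>
  define e where "e = measure \<mu> ?N / (4 * doubling_const + 1)"
  have e: "0 < e" using pos doubling_const_ge_1 by (simp add: e_def)
  obtain U where U: "open U" "E \<inter> Q \<subseteq> U" "U \<subseteq> Q" "emeasure \<mu> (U - E \<inter> Q) < ennreal e"
    using weighted_measure_outer_open[OF weight_integrable EQ Int_lower2 open_cylinder cylinder_emeasure(2)[OF R], of "ennreal e"] e
    by auto
  define \<F> where "\<F> = {(P, r). 0 < r \<and> cylinder \<iota> r P \<subseteq> U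
      \<and> measure \<mu> (E \<inter> cylinder \<iota> r P) \<le> 3 / 4 * measure \<mu> (cylinder \<iota> r P)}"
  have cover: "?N \<subseteq> (\<Union>(P, r)\<in>\<F>. cylinder \<iota> r P)"
  proof
    fix X assume X: "X \<in> ?N"
    then have XQ: "X \<in> Q" using NQ by blast
    then have "X \<in> U" using X U(2) by blast
    then obtain s where s: "0 < s" "s \<le> r0" "pulled X s \<subseteq> U"
      using pulled_small[OF XQ U(1), of r0] r0 by auto
    have "measure \<mu> (E \<inter> pulled X s) \<le> 1 / 2 * measure \<mu> (pulled X s)"
      using X by (intro stopping[OF E r0 small _ _ s(1,2)]) blast+
    moreover have "0 \<le> measure \<mu> (pulled X s)" by simp
    ultimately have "measure \<mu> (E \<inter> pulled X s) \<le> 3 / 4 * measure \<mu> (pulled X s)" by linarith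
    then have "(pulled_center X s, s * R) \<in> \<F>" using s R by (simp add: \<F>_def)
    then show "X \<in> (\<Union>(P, r)\<in>\<F>. cylinder \<iota> r P)" using pulled_contains[OF XQ s(1)] by blast
  qed
  have oF: "open (\<Union>(P, r)\<in>\<F>. cylinder \<iota> r P)"
    by (auto intro!: open_UN open_cylinder simp: case_prod_beta)
  have "emeasure \<mu> ?N \<le> emeasure \<mu> (\<Union>(P, r)\<in>\<F>. cylinder \<iota> r P)"
    by (rule emeasure_mono[OF cover open_in_weighted_sets[OF oF]])
  also have "\<dots> \<le> ennreal (4 * doubling_const) * emeasure \<mu> (U - E)"
    using U(1) by (intro covering_bound[OF E]) (auto simp: \<F>_def)
  also have "U - E = U - E \<inter> Q" using U(3) by blast
  also have "ennreal (4 * doubling_const) * emeasure \<mu> (U - E \<inter> Q) \<le> ennreal (4 * doubling_const) * ennreal e"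
    using U(4) by (intro mult_left_mono) auto
  also have "\<dots> = ennreal (4 * doubling_const * e)" using doubling_const_ge_1 e by (simp add: ennreal_mult)
  finally have "ennreal (measure \<mu> ?N) \<le> ennreal (4 * doubling_const * e)"
    unfolding emeasure_eq_measure2[OF Q_fmeasurable[OF NQ N]] .
  moreover have "0 \<le> 4 * doubling_const * e" using doubling_const_ge_1 e by simp
  ultimately have "measure \<mu> ?N \<le> 4 * doubling_const * e" using ennreal_le_iff by blast
  moreover have "measure \<mu> ?N = (4 * doubling_const + 1) * e" using doubling_const_ge_1 by (simp add: e_def)
  moreover have "(4 * doubling_const + 1) * e = 4 * doubling_const * e + e" by (simp add: distrib_right)
  ultimately show False using e by linarith
qed

text \<open>
  Almost all of the deep part of \<open>E\<close> lies in \<open>spots E\<close>, and by the covering lemma with \<open>W = spots E\<close> a fraction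
  of at least \<open>1 / (4 doubling_const)\<close> of \<open>spots E\<close> is not in \<open>E\<close>.
\<close>

lemma deep_measure_le:
  assumes E: "E \<in> sets lebesgue" and r0: "0 < r0" "r0 < 1"
    and small: "\<And>P r. 0 < r \<Longrightarrow> cylinder \<iota> r P \<subseteq> Q \<Longrightarrow>
      measure \<mu> (E \<inter> cylinder \<iota> r P) > 1 / 2 * measure \<mu> (cylinder \<iota> r P) \<Longrightarrow> r < r0 * R"
  shows "measure \<mu> (E \<inter> deep r0) \<le> (1 - 1 / (4 * doubling_const)) * measure \<mu> (spots E)"
proof -
  have Gf: "spots E \<in> fmeasurable \<mu>" by (intro Q_fmeasurable spots_subset spots_sets)
  have GE: "spots E - E \<in> fmeasurable \<mu>" using Gf E by (intro fmeasurable_Diff) auto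
  have "emeasure \<mu> (spots E) \<le> ennreal (4 * doubling_const) * emeasure \<mu> (spots E - E)"
  proof (rule covering_bound[OF E spots_sets])
    fix P r assume Pr: "(P, r) \<in> half_full E"
    then have "cylinder \<iota> r P \<subseteq> spots E" by blast
    then show "0 < r \<and> cylinder \<iota> r P \<subseteq> spots E
        \<and> measure \<mu> (E \<inter> cylinder \<iota> r P) \<le> 3 / 4 * measure \<mu> (cylinder \<iota> r P)"
      using Pr unfolding half_full_def by simp
  qed
  then have "ennreal (measure \<mu> (spots E)) \<le> ennreal (4 * doubling_const * measure \<mu> (spots E - E))"
    unfolding emeasure_eq_measure2[OF Gf] emeasure_eq_measure2[OF GE]
    using doubling_const_ge_1 by (subst ennreal_mult) auto
  moreover have "0 \<le> 4 * doubling_const * measure \<mu> (spots E - E)" using doubling_const_ge_1 by simp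
  ultimately have le: "measure \<mu> (spots E) \<le> 4 * doubling_const * measure \<mu> (spots E - E)"
    using ennreal_le_iff by blast
  have N: "E \<inter> deep r0 - spots E \<in> fmeasurable \<mu>"
    using deep_subset by (intro Q_fmeasurable sets.Diff sets.Int E deep_sets spots_sets) blast
  have EG: "E \<inter> spots E \<in> fmeasurable \<mu>"
    using spots_subset by (intro Q_fmeasurable sets.Int E spots_sets) blast
  have null: "measure \<mu> (E \<inter> deep r0 - spots E) = 0"
    by (rule deep_outside_spots_null[OF E r0 small])
  have "measure \<mu> (E \<inter> deep r0) \<le> measure \<mu> ((E \<inter> spots E) \<union> (E \<inter> deep r0 - spots E))"
    using E deep_sets EG N by (intro measure_mono_fmeasurable) auto
  also have "\<dots> \<le> measure \<mu> (E \<inter> spots E) + measure \<mu> (E \<inter> deep r0 - spots E)"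
    using EG N by (intro measure_Un_le) auto
  also have "\<dots> = measure \<mu> (spots E) - measure \<mu> (spots E - E)"
    using null measure_split[OF Gf E] by linarith
  also have "\<dots> \<le> (1 - 1 / (4 * doubling_const)) * measure \<mu> (spots E)"
    using le doubling_const_ge_1 by (simp add: field_simps)
  finally show ?thesis .
qed

section \<open>Shallow layer, leakage and conclusion\<close>

abbreviation around :: "real \<Rightarrow> real set \<Rightarrow> ('n, 'm) point set" where
  "around \<rho> I \<equiv> tube x0 R (y0 - t0 *\<^sub>R velocity \<iota> x0) (velocity \<iota> x0) \<rho> I"

lemma Q_around: "Q = around (R ^ 3) {t0 - R\<^sup>2<..<t0}"
  by (rule cylinder_tube)

lemma in_around: "(x, y, t) \<in> around \<rho> I \<longleftrightarrow>
    norm (x - x0) < R \<and> norm (y - y0 - (t - t0) *\<^sub>R velocity \<iota> x0) < \<rho> \<and> t \<in> I"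
  unfolding in_tube by (simp add: algebra_simps)

lemma around_sets: "around \<rho> {s<..<t} \<in> sets lebesgue"
  by (simp add: open_tube)

lemma around_fmeasurable:
  assumes "0 \<le> \<rho>" "s \<le> t" shows "around \<rho> {s<..<t} \<in> fmeasurable \<mu>"
  by (rule fmeasurableI) (simp_all add: around_sets measure_tube(1)[OF weight_integrable assms])

lemma measure_around:
  assumes "0 \<le> \<rho>" "0 \<le> s"
  shows "measure \<mu> (around (\<rho> * R ^ 3) {t0 - R\<^sup>2<..<t0 + s * R\<^sup>2}) = \<rho> ^ CARD('m) * (1 + s) * measure \<mu> Q"
proof -
  have R2: "0 < R\<^sup>2" using R by simp
  have len: "t0 + s * R\<^sup>2 - (t0 - R\<^sup>2) = (1 + s) * R\<^sup>2" "t0 - (t0 - R\<^sup>2) = R\<^sup>2"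
    by (auto simp: algebra_simps)
  have le: "t0 - R\<^sup>2 \<le> t0 + s * R\<^sup>2" "t0 - R\<^sup>2 \<le> t0"
    using mult_nonneg_nonneg[OF assms(2), of "R\<^sup>2"] R2 by linarith+
  have \<rho>: "0 \<le> \<rho> * R ^ 3" "0 \<le> R ^ 3" using assms(1) R by auto
  show ?thesis
    unfolding Q_around measure_tube(2)[OF weight_integrable \<rho>(1) le(1)] measure_tube(2)[OF weight_integrable \<rho>(2) le(2)] len
    by (simp add: power_mult_distrib)
qed

text \<open>
  The layer has relative width \<open>2 r\<^sub>0\<^sup>2\<close> in \<open>y\<close>, where the measure is homogeneous, so Bernoulli's inequality
  bounds it.
\<close>

lemma shallow_measure_le:
  assumes r0: "0 < r0"
  shows "measure \<mu> (Q - deep r0) \<le> 2 * real CARD('m) * r0\<^sup>2 * measure \<mu> Q"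
proof (cases "1 \<le> 2 * r0\<^sup>2")
  case True
  have "measure \<mu> (Q - deep r0) \<le> measure \<mu> Q"
    using Q_sets deep_sets by (intro measure_mono_fmeasurable Q_fmeasurable) auto
  also have "\<dots> = 1 * measure \<mu> Q" by simp
  also have "\<dots> \<le> 2 * real CARD('m) * r0\<^sup>2 * measure \<mu> Q"
  proof (rule mult_right_mono)
    have "1 * 1 \<le> real CARD('m) * (2 * r0\<^sup>2)"
      using True by (intro mult_mono) (auto simp: Suc_le_eq)
    then show "1 \<le> 2 * real CARD('m) * r0\<^sup>2" by (simp add: ac_simps)
  qed simp
  finally show ?thesis .
next
  case False
  define T where "T = around ((1 - 2 * r0\<^sup>2) * R ^ 3) {t0 - R\<^sup>2<..<t0 + 0 * R\<^sup>2}"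
  have T: "T \<in> sets lebesgue" unfolding T_def by (rule around_sets)
  have R3: "0 < R ^ 3" using R by simp
  have less: "(1 - 2 * r0\<^sup>2) * R ^ 3 \<le> R ^ 3" using R3 by (simp add: algebra_simps)
  have TQ: "T \<subseteq> Q"
  proof
    fix z assume "z \<in> T"
    then show "z \<in> Q" using less unfolding T_def by (cases z) (simp only: in_around in_Q, auto)
  qed
  have Q: "Q \<in> fmeasurable \<mu>" using Q_sets by (intro Q_fmeasurable) auto
  have "Q - deep r0 \<subseteq> Q - T"
  proof
    fix z assume z: "z \<in> Q - deep r0"
    obtain x y t where zz: "z = (x, y, t)" by (cases z)
    have "z \<notin> T"
    proof
      assume "z \<in> T"
      then have "norm (y - y0 - (t - t0) *\<^sub>R velocity \<iota> x0) < (1 - 2 * r0\<^sup>2) * R ^ 3"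
        unfolding zz T_def in_around by blast
      then have "z \<in> deep r0" using z unfolding zz deep_def by (simp add: algebra_simps)
      then show False using z by blast
    qed
    then show "z \<in> Q - T" using z by blast
  qed
  then have "measure \<mu> (Q - deep r0) \<le> measure \<mu> (Q - T)"
    using Q T Q_sets deep_sets by (intro measure_mono_fmeasurable fmeasurable_Diff) auto
  also have "\<dots> = measure \<mu> Q - measure \<mu> T"
    using measure_split[OF Q T] TQ by (simp add: Int_absorb2)
  also have "measure \<mu> T = (1 - 2 * r0\<^sup>2) ^ CARD('m) * measure \<mu> Q"
    unfolding T_def using False by (subst measure_around) auto
  also have "measure \<mu> Q - \<dots> = (1 - (1 - 2 * r0\<^sup>2) ^ CARD('m)) * measure \<mu> Q"
    by (simp add: algebra_simps)
  also have "\<dots> \<le> 2 * real CARD('m) * r0\<^sup>2 * measure \<mu> Q"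
  proof (rule mult_right_mono)
    show "1 - (1 - 2 * r0\<^sup>2) ^ CARD('m) \<le> 2 * real CARD('m) * r0\<^sup>2"
      using Bernoulli_inequality[of "- (2 * r0\<^sup>2)" "CARD('m)"] False by simp
  qed simp
  finally show ?thesis .
qed

text \<open>
  In \<open>x\<close> the stack sits over the same ball as the cylinder. In \<open>y\<close> it leaves \<open>Q\<close> by its own width
  \<open>(L + 2) r\<^sup>3\<close> and by the drift \<open>(L + 1) r\<^sup>2 R\<close> relative to \<open>Q\<close>, together at most \<open>(2 L + 3) r\<^sub>0\<^sup>2 R\<^sup>3\<close>;
  this is where the factor \<open>5\<close> comes from.
\<close>

lemma stack_subset_around:
  assumes sub: "cylinder \<iota> r P \<subseteq> Q" and r: "0 < r" "r \<le> r0 * R" and r0: "0 < r0" "r0 \<le> 1"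
    and L: "1 \<le> L"
  shows "forward_stack \<iota> L r P \<subseteq>
    around ((1 + 5 * (real L * r0\<^sup>2)) * R ^ 3) {t0 - R\<^sup>2<..<t0 + real L * r0\<^sup>2 * R\<^sup>2}"
proof
  fix z assume z: "z \<in> forward_stack \<iota> L r P"
  obtain a b c where P: "P = (a, b, c)" by (cases P)
  obtain x y t where zz: "z = (x, y, t)" by (cases z)
  let ?u = "velocity \<iota> a" and ?v = "velocity \<iota> x0"
  have s: "norm (x - a) < r" "norm (y - b - (t - c) *\<^sub>R ?u) < (real L + 2) * r ^ 3"
    "c < t" "t < c + real L * r\<^sup>2"
    using z unfolding zz P forward_stack.simps by auto
  have r2: "0 < r\<^sup>2" using r by simp
  have core: "(x', b + (t' - c) *\<^sub>R ?u, t') \<in> Q" if "norm (x' - a) < r" "c - r\<^sup>2 < t'" "t' < c" for x' t'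
  proof -
    have "(x', b + (t' - c) *\<^sub>R ?u, t') \<in> cylinder \<iota> r P"
      using that r unfolding P cylinder.simps by simp
    then show ?thesis using sub by (rule subsetD[rotated])
  qed
  \<comment> \<open>Any time strictly inside the life span of the cylinder would do.\<close>
  define t' where "t' = c - r\<^sup>2 / 2"
  have t': "c - r\<^sup>2 < t'" "t' < c" using r2 by (auto simp: t'_def)
  have X: "norm (x - x0) < R" using core[OF s(1) t'] unfolding in_Q by blast
  have Qa: "norm (a - x0) < R" "norm (b + (t' - c) *\<^sub>R ?u - y0 - (t' - t0) *\<^sub>R ?v) < R ^ 3" "t0 - R\<^sup>2 < t'"
    using core[of a t'] t' r unfolding in_Q by auto
  \<comment> \<open>The top of the cylinder is a limit of its points, which all lie below the top of the reference cylinder.\<close>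
  have c: "c \<le> t0"
  proof (rule dense_le_bounded[of "c - r\<^sup>2"])
    show "c - r\<^sup>2 < c" using r2 by simp
    show "t'' \<le> t0" if "c - r\<^sup>2 < t''" "t'' < c" for t''
      using core[of a t''] that r unfolding in_Q by auto
  qed
  have rr: "r\<^sup>2 \<le> r0\<^sup>2 * R\<^sup>2" using power_mono[OF r(2), of 2] r by (simp add: power_mult_distrib)
  have T: "t0 - R\<^sup>2 < t" "t < t0 + real L * r0\<^sup>2 * R\<^sup>2"
  proof -
    show "t0 - R\<^sup>2 < t" using Qa(3) t' s(3) by linarith
    have "real L * r\<^sup>2 \<le> real L * (r0\<^sup>2 * R\<^sup>2)" using rr by (intro mult_left_mono) auto
    then show "t < t0 + real L * r0\<^sup>2 * R\<^sup>2" using s(4) c by (simp add: ac_simps)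
  qed
  have rR: "r \<le> R" using r r0 R mult_right_mono[of r0 1 R] by linarith
  have du: "norm (?u - ?v) \<le> R" using velocity_lipschitz[OF inj, of a x0] Qa(1) by linarith
  have "0 \<le> t - t'" "t - t' \<le> (real L + 1) * r\<^sup>2"
    using s(3,4) t' by (auto simp: algebra_simps)
  then have "(t - t') * norm (?u - ?v) \<le> ((real L + 1) * r\<^sup>2) * R"
    using du by (intro mult_mono) auto
  then have drift: "norm ((t - t') *\<^sub>R (?u - ?v)) \<le> (real L + 1) * (r\<^sup>2 * R)"
    using \<open>0 \<le> t - t'\<close> by (simp add: ac_simps)
  have cube: "(real L + 2) * r ^ 3 \<le> (real L + 2) * (r\<^sup>2 * R)"
  proof -
    have "r\<^sup>2 * r \<le> r\<^sup>2 * R" using rR by (intro mult_left_mono) auto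
    then have "r ^ 3 \<le> r\<^sup>2 * R" by (simp add: power2_eq_square power3_eq_cube)
    then show ?thesis by (intro mult_left_mono) auto
  qed
  have "y - y0 - (t - t0) *\<^sub>R ?v = (y - b - (t - c) *\<^sub>R ?u)
      + (b + (t' - c) *\<^sub>R ?u - y0 - (t' - t0) *\<^sub>R ?v) + (t - t') *\<^sub>R (?u - ?v)"
    by (simp add: algebra_simps)
  also have "norm \<dots> \<le> norm (y - b - (t - c) *\<^sub>R ?u)
      + norm (b + (t' - c) *\<^sub>R ?u - y0 - (t' - t0) *\<^sub>R ?v) + norm ((t - t') *\<^sub>R (?u - ?v))"
    by (intro order_trans[OF norm_triangle_ineq] add_right_mono norm_triangle_ineq)
  also have "\<dots> < (real L + 2) * (r\<^sup>2 * R) + R ^ 3 + (real L + 1) * (r\<^sup>2 * R)"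
    using s(2) cube Qa(2) drift by linarith
  also have "\<dots> = (2 * real L + 3) * (r\<^sup>2 * R) + R ^ 3" by (simp add: algebra_simps)
  also have "\<dots> \<le> (5 * real L) * (r0\<^sup>2 * R\<^sup>2 * R) + R ^ 3"
    using rr R L by (intro add_right_mono mult_mono mult_right_mono) auto
  also have "\<dots> = (1 + 5 * (real L * r0\<^sup>2)) * R ^ 3"
    by (simp add: algebra_simps power2_eq_square power3_eq_cube)
  finally show "z \<in> around ((1 + 5 * (real L * r0\<^sup>2)) * R ^ 3) {t0 - R\<^sup>2<..<t0 + real L * r0\<^sup>2 * R\<^sup>2}"
    using X T unfolding zz in_around by (simp only: greaterThanLessThan_iff)
qed

lemma leak_measure_le:
  assumes \<sigma>: "0 \<le> \<sigma>" "\<sigma> \<le> 1"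
  defines "T \<equiv> around ((1 + 5 * \<sigma>) * R ^ 3) {t0 - R\<^sup>2<..<t0 + \<sigma> * R\<^sup>2}"
  shows "T \<in> fmeasurable \<mu>" and "measure \<mu> (T - Q) \<le> 6 ^ Suc CARD('m) * \<sigma> * measure \<mu> Q"
proof -
  have le: "t0 - R\<^sup>2 \<le> t0" "t0 \<le> t0 + \<sigma> * R\<^sup>2" using R \<sigma> by auto
  have R3: "0 \<le> (1 + 5 * \<sigma>) * R ^ 3" "R ^ 3 \<le> (1 + 5 * \<sigma>) * R ^ 3"
    using R \<sigma> by (auto simp: algebra_simps)
  show T: "T \<in> fmeasurable \<mu>"
    unfolding T_def using le by (intro around_fmeasurable R3(1)) linarith
  have QT: "Q \<subseteq> T"
  proof
    fix z assume "z \<in> Q"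
    then show "z \<in> T" using R3 le unfolding T_def by (cases z) (simp only: in_around in_Q, auto)
  qed
  have "measure \<mu> (T - Q) = measure \<mu> T - measure \<mu> Q"
    using measure_split[OF T Q_sets] QT by (simp add: Int_absorb2)
  also have "measure \<mu> T = (1 + 5 * \<sigma>) ^ CARD('m) * (1 + \<sigma>) * measure \<mu> Q"
    unfolding T_def using \<sigma> by (intro measure_around) auto
  also have "\<dots> \<le> (1 + 5 * \<sigma>) ^ Suc CARD('m) * measure \<mu> Q"
    using \<sigma> by (simp add: mult_left_mono mult_right_mono ac_simps)
  also have "\<dots> \<le> (1 + \<sigma> * (6 ^ Suc CARD('m) - 1)) * measure \<mu> Q"
    using power_one_plus_le[of \<sigma> 5 "Suc CARD('m)"] \<sigma> by (intro mult_right_mono) auto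
  finally have "measure \<mu> (T - Q) \<le> (1 + \<sigma> * (6 ^ Suc CARD('m) - 1)) * measure \<mu> Q - measure \<mu> Q"
    by simp
  also have "\<dots> = \<sigma> * (6 ^ Suc CARD('m) - 1) * measure \<mu> Q" by (simp add: algebra_simps)
  also have "\<dots> \<le> \<sigma> * 6 ^ Suc CARD('m) * measure \<mu> Q"
    using \<sigma> by (intro mult_right_mono mult_left_mono) auto
  finally show "measure \<mu> (T - Q) \<le> 6 ^ Suc CARD('m) * \<sigma> * measure \<mu> Q" by (simp add: ac_simps)
qed

lemma spots_measure_le:
  assumes F: "F \<in> sets lebesgue" and L: "1 \<le> L" and r0: "0 < r0" "r0 < 1" "real L * r0\<^sup>2 \<le> 1"
    and growth: "\<And>P r. (P, r) \<in> half_full E \<Longrightarrow>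
      r < r0 * R \<and> emeasure \<mu> (forward_stack \<iota> L r P - F) = 0"
  shows "measure \<mu> (spots E) \<le> (real L + 1) / real L *
    (measure \<mu> (F \<inter> Q) + 6 ^ Suc CARD('m) * (real L * r0\<^sup>2) * measure \<mu> Q)"
proof (cases "half_full E = {}")
  case True
  then show ?thesis using r0 by simp
next
  case False
  let ?\<sigma> = "real L * r0\<^sup>2"
  define T where "T = around ((1 + 5 * ?\<sigma>) * R ^ 3) {t0 - R\<^sup>2<..<t0 + ?\<sigma> * R\<^sup>2}"
  have \<sigma>: "0 \<le> ?\<sigma>" "?\<sigma> \<le> 1" using r0 by auto
  note T = leak_measure_le[OF \<sigma>, folded T_def]
  let ?cyl = "\<lambda>(P, r). cylinder \<iota> r P"
  obtain \<G> where \<G>: "countable \<G>" "\<G> \<subseteq> half_full E" and U: "spots E = (\<Union>p\<in>\<G>. ?cyl p)"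
    by (rule countable_subfamily_of_cylinders)
  show ?thesis
  proof (cases "\<G> = {}")
    case True
    then show ?thesis unfolding U using r0 by simp
  next
    case False
    define P where "P i = fst (from_nat_into \<G> i)" for i
    define r where "r i = snd (from_nat_into \<G> i)" for i
    have mem: "(P i, r i) \<in> half_full E" for i
      using from_nat_into[OF False, of i] \<G>(2) unfolding P_def r_def prod.collapse by (rule subsetD[rotated])
    have ri: "0 < r i" "cylinder \<iota> (r i) (P i) \<subseteq> Q" for i
      using mem[of i] unfolding half_full_def by blast+
    have "\<G> = range (from_nat_into \<G>)" by (rule range_from_nat_into[OF False \<G>(1), symmetric])
    then have "spots E = (\<Union>p\<in>range (from_nat_into \<G>). ?cyl p)" unfolding U by (rule arg_cong)
    also have "\<dots> = (\<Union>i. cylinder \<iota> (r i) (P i))"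
      unfolding image_image P_def r_def case_prod_beta ..
    finally have G: "spots E = (\<Union>i. cylinder \<iota> (r i) (P i))" .
    let ?S = "\<Union>i. forward_stack \<iota> L (r i) (P i)"
    have "open ?S" by (intro open_UN ballI open_forward_stack)
    then have S: "?S \<in> sets lebesgue" using open_in_weighted_sets by simp
    have ST: "?S \<subseteq> T"
      unfolding T_def using growth[OF mem] ri r0 L
      by (intro UN_least stack_subset_around) (auto intro: less_imp_le)
    have Sf: "?S \<in> fmeasurable \<mu>" using S ST T(1) by (intro fmeasurableI2[OF T(1)]) auto
    have FQ: "F \<inter> Q \<in> fmeasurable \<mu>" using F Q_sets by (intro Q_fmeasurable sets.Int) auto
    have null: "?S - F \<in> null_sets \<mu>"
    proof -
      have "forward_stack \<iota> L (r i) (P i) - F \<in> null_sets \<mu>" for i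
      proof (rule null_setsI)
        show "emeasure \<mu> (forward_stack \<iota> L (r i) (P i) - F) = 0" using growth[OF mem, of i] by simp
        show "forward_stack \<iota> L (r i) (P i) - F \<in> sets \<mu>"
          using F by (intro sets.Diff open_in_weighted_sets[OF open_forward_stack]) simp
      qed
      then have "(\<Union>i. forward_stack \<iota> L (r i) (P i) - F) \<in> null_sets \<mu>" by (intro null_sets_UN)
      then show ?thesis by simp
    qed
    have TQ: "T - Q \<in> fmeasurable \<mu>" using T(1) Q_sets by (intro fmeasurable_Diff) auto
    have "measure \<mu> ?S \<le> measure \<mu> ((F \<inter> Q \<union> (T - Q)) \<union> (?S - F))"
      using ST S TQ FQ null
      by (intro measure_mono_fmeasurable fmeasurable.Un) (auto intro: fmeasurableI_null_sets)
    also have "\<dots> = measure \<mu> (F \<inter> Q \<union> (T - Q))"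
      by (rule measure_Un_null_set[OF fmeasurableD[OF fmeasurable.Un[OF FQ TQ]] null])
    also have "\<dots> \<le> measure \<mu> (F \<inter> Q) + measure \<mu> (T - Q)"
      using FQ TQ by (intro measure_Un_le) auto
    finally have Sle: "measure \<mu> ?S \<le> measure \<mu> (F \<inter> Q) + 6 ^ Suc CARD('m) * ?\<sigma> * measure \<mu> Q"
      using T(2) by linarith
    have Gf: "spots E \<in> fmeasurable \<mu>" by (intro Q_fmeasurable spots_subset spots_sets)
    have "emeasure \<mu> (spots E) \<le> ennreal ((real L + 1) / real L) * emeasure \<mu> ?S"
      unfolding G by (rule stacking_lemma[OF weight_integrable inj ri(1) L])
    also have "\<dots> = ennreal ((real L + 1) / real L * measure \<mu> ?S)"
      unfolding emeasure_eq_measure2[OF Sf] by (subst ennreal_mult) auto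
    finally have "ennreal (measure \<mu> (spots E)) \<le> ennreal ((real L + 1) / real L * measure \<mu> ?S)"
      unfolding emeasure_eq_measure2[OF Gf] .
    moreover have "0 \<le> (real L + 1) / real L * measure \<mu> ?S" by simp
    ultimately have "measure \<mu> (spots E) \<le> (real L + 1) / real L * measure \<mu> ?S"
      using ennreal_le_iff by blast
    also have "\<dots> \<le> (real L + 1) / real L * (measure \<mu> (F \<inter> Q) + 6 ^ Suc CARD('m) * ?\<sigma> * measure \<mu> Q)"
      using Sle by (intro mult_left_mono) auto
    finally show ?thesis .
  qed
qed

lemma ink_spots:
  assumes E: "E \<in> sets lebesgue" and F: "F \<in> sets lebesgue" and L: "1 \<le> L"
    and r0: "0 < r0" "r0 < 1" "real L * r0\<^sup>2 \<le> 1"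
    and growth: "\<And>P r. 0 < r \<Longrightarrow> cylinder \<iota> r P \<subseteq> Q \<Longrightarrow>
      measure \<mu> (E \<inter> cylinder \<iota> r P) > 1 / 2 * measure \<mu> (cylinder \<iota> r P) \<Longrightarrow>
      r < r0 * R \<and> emeasure \<mu> (forward_stack \<iota> L r P - F) = 0"
  shows "measure \<mu> (E \<inter> Q) \<le> (real L + 1) / real L * (1 - 1 / (4 * doubling_const)) * measure \<mu> (F \<inter> Q)
    + (2 * 6 ^ Suc CARD('m) + 2 * real CARD('m)) * real L * r0\<^sup>2 * measure \<mu> Q"
proof -
  let ?c = "1 - 1 / (4 * doubling_const)" and ?K = "6 ^ Suc CARD('m) :: real" and ?k = "(real L + 1) / real L"
  have c: "0 \<le> ?c" "?c \<le> 1" using doubling_const_ge_1 by (auto simp: field_simps)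
  have small: "r < r0 * R" if "0 < r" "cylinder \<iota> r P \<subseteq> Q"
    "measure \<mu> (E \<inter> cylinder \<iota> r P) > 1 / 2 * measure \<mu> (cylinder \<iota> r P)" for P r
    using growth[OF that] by (rule conjunct1)
  have hf: "r < r0 * R \<and> emeasure \<mu> (forward_stack \<iota> L r P - F) = 0" if "(P, r) \<in> half_full E" for P r
    using that unfolding half_full_def by (intro growth) auto
  have fm: "E \<inter> deep r0 \<in> fmeasurable \<mu>" "Q - deep r0 \<in> fmeasurable \<mu>"
    using deep_subset by (intro Q_fmeasurable sets.Int sets.Diff E deep_sets Q_sets; blast)+
  have "measure \<mu> (E \<inter> Q) \<le> measure \<mu> ((E \<inter> deep r0) \<union> (Q - deep r0))"
    using fm E Q_sets by (intro measure_mono_fmeasurable fmeasurable.Un) auto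
  also have "\<dots> \<le> measure \<mu> (E \<inter> deep r0) + measure \<mu> (Q - deep r0)"
    using fm by (intro measure_Un_le) auto
  also have "\<dots> \<le> ?c * measure \<mu> (spots E) + 2 * real CARD('m) * r0\<^sup>2 * measure \<mu> Q"
    by (rule add_mono[OF deep_measure_le[OF E r0(1,2) small] shallow_measure_le[OF r0(1)]])
  also have "\<dots> \<le> ?c * (?k * (measure \<mu> (F \<inter> Q) + ?K * (real L * r0\<^sup>2) * measure \<mu> Q))
      + 2 * real CARD('m) * r0\<^sup>2 * measure \<mu> Q"
    by (intro add_right_mono mult_left_mono c(1) spots_measure_le[OF F L r0 hf])
  also have "\<dots> = ?k * ?c * measure \<mu> (F \<inter> Q) + (?c * ?k) * (?K * (real L * r0\<^sup>2) * measure \<mu> Q)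
      + 2 * real CARD('m) * 1 * (r0\<^sup>2 * measure \<mu> Q)"
  proof -
    have "a * (k * (f + s)) + 2 * m * q * p = k * a * f + (a * k) * s + 2 * m * 1 * (q * p)"
      for a k f s m q p :: real by (simp add: algebra_simps)
    then show ?thesis .
  qed
  also have "\<dots> \<le> ?k * ?c * measure \<mu> (F \<inter> Q) + (1 * 2) * (?K * (real L * r0\<^sup>2) * measure \<mu> Q)
      + 2 * real CARD('m) * real L * (r0\<^sup>2 * measure \<mu> Q)"
  proof (intro add_mono mult_right_mono mult_mono mult_left_mono order_refl c)
    show "?k \<le> 2" using L by (simp add: field_simps)
  qed (use L in auto)
  also have "\<dots> = ?k * ?c * measure \<mu> (F \<inter> Q) + (2 * ?K + 2 * real CARD('m)) * real L * r0\<^sup>2 * measure \<mu> Q"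
    by (simp add: algebra_simps)
  finally show ?thesis .
qed

end

theorem lemma7p7:
  fixes \<iota> :: "'m::finite \<Rightarrow> 'n::finite" and M R :: real and P0 :: "('n, 'm) point"
  assumes "inj \<iota>" and "R > 0"
  shows "\<exists>c C \<sigma>0 :: real. 0 < c \<and> c < 1 \<and> 0 < \<sigma>0 \<and> \<sigma>0 \<le> 2 \<and>
    (\<forall>(w :: real ^ 'n \<Rightarrow> real) (E :: ('n, 'm) point set) (F :: ('n, 'm) point set)
        (L :: nat) (r0 :: real).
      A2_weight_le M w \<longrightarrow>
      E \<in> sets lebesgue \<longrightarrow> F \<in> sets lebesgue \<longrightarrow> E \<subseteq> F \<longrightarrow>
      1 \<le> L \<longrightarrow> 0 < r0 \<longrightarrow> r0 < 1 \<longrightarrow> real L * r0\<^sup>2 \<le> 1 \<longrightarrow>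
      (\<forall>P r. 0 < r \<longrightarrow> cylinder \<iota> r P \<subseteq> cylinder \<iota> R P0 \<longrightarrow>
         measure (weighted_measure w) (E \<inter> cylinder \<iota> r P)
           > 1 / 2 * measure (weighted_measure w) (cylinder \<iota> r P) \<longrightarrow>
         r < r0 * R \<and> emeasure (weighted_measure w) (forward_stack \<iota> L r P - F) = 0) \<longrightarrow>
      measure (weighted_measure w) (E \<inter> cylinder \<iota> R P0)
        \<le> (real L + 1) / real L * (1 - c) * measure (weighted_measure w) (F \<inter> cylinder \<iota> R P0)
          + C * real L * (r0 powr \<sigma>0) * measure (weighted_measure w) (cylinder \<iota> R P0))"
proof -
  obtain x0 y0 t0 where P0: "P0 = (x0, y0, t0)" by (cases P0)
  \<comment> \<open>The doubling constant for cylinders depends only on \<open>M\<close> and the dimensions, so it is fixed before the weight.\<close>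
  define K :: real where "K = max M 1 * (3 ^ CARD('n))\<^sup>2 * 27 ^ CARD('m) * 18"
  define c where "c = 1 / (4 * K)"
  define C :: real where "C = 2 * 6 ^ Suc CARD('m) + 2 * real CARD('m)"
  have "1 * 1 * 1 * 1 \<le> K" unfolding K_def by (intro mult_mono) (auto simp: one_le_power)
  then have K: "1 \<le> K" by simp
  show ?thesis
  proof (rule exI[of _ c], rule exI[of _ C], rule exI[of _ 2], intro conjI allI impI)
    show "0 < c" "c < 1" using K by (auto simp: c_def field_simps)
  next
    fix w :: "real ^ 'n \<Rightarrow> real" and E F :: "('n, 'm) point set" and L :: nat and r0 :: real
    assume w: "A2_weight_le M w" and EF: "E \<in> sets lebesgue" "F \<in> sets lebesgue" and L: "1 \<le> L"
      and r0: "0 < r0" "r0 < 1" "real L * r0\<^sup>2 \<le> 1"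
      and growth: "\<forall>P r. 0 < r \<longrightarrow> cylinder \<iota> r P \<subseteq> cylinder \<iota> R P0 \<longrightarrow>
         measure (weighted_measure w) (E \<inter> cylinder \<iota> r P)
           > 1 / 2 * measure (weighted_measure w) (cylinder \<iota> r P) \<longrightarrow>
         r < r0 * R \<and> emeasure (weighted_measure w) (forward_stack \<iota> L r P - F) = 0"
    interpret reference_cylinder \<iota> w M R x0 y0 t0
      using assms w by unfold_locales auto
    have "measure (weighted_measure w) (E \<inter> cylinder \<iota> R P0)
        \<le> (real L + 1) / real L * (1 - c) * measure (weighted_measure w) (F \<inter> cylinder \<iota> R P0)
          + C * real L * r0\<^sup>2 * measure (weighted_measure w) (cylinder \<iota> R P0)"
      unfolding P0 c_def C_def K_def
      by (rule ink_spots[OF EF L r0, unfolded doubling_const_def]) (use growth[unfolded P0] in blast)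
    then show "measure (weighted_measure w) (E \<inter> cylinder \<iota> R P0)
        \<le> (real L + 1) / real L * (1 - c) * measure (weighted_measure w) (F \<inter> cylinder \<iota> R P0)
          + C * real L * (r0 powr 2) * measure (weighted_measure w) (cylinder \<iota> R P0)"
      using r0(1) by (simp add: powr_realpow[of r0 2, simplified])
  qed auto
qed

end
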